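(* Let $d\ge 1$. For odd integers $L\ge 1$, let $f_L$ be sampled from $\mu^{\Lambda(L),0}$. Then exactly one of the following alternatives holds: (i) The set of random variables $(f_L(\mathbf 0))_{L\ge 1\text{ odd}}$ is not tight. Precisely, $$\lim_{M\to\infty}\ \sup_{L\ge 1\text{ odd}}\ \mathbb{P}(|f_L(\mathbf 0)|>M)>0.$$ (ii) The sequence of finite-volume Gibbs measures $(\mu^{\Lambda(L),0})$, $L\ge 1$ odd, converges in distribution to a $\mathbb{Z}^d_{\mathrm{even}}$-translation-invariant Gibbs measure.
   Context: For $v\in\mathbb{Z}^d$ let $\|v\|_1=|v_1|+\dots+|v_d|$; $u,v$ are adjacent if $\|u-v\|_1=1$; $\mathbf 0$ is the origin. $\mathbb{Z}^d_{\mathrm{even}}=\{v\in\mathbb{Z}^d:\|v\|_1\text{ even}\}$ and $\Lambda(L)=\{v\in\mathbb{Z}^d:\|v\|_1\le L\}$. For $\Lambda\subset\mathbb{Z}^d$, $\partial_\circ\Lambda$ is the set of $v\notin\Lambda$ adjacent to some vertex of $\Lambda$, and $\Lambda^+=\Lambda\cup\partial_\circ\Lambda$. A homomorphism height function on $D\subset\mathbb{Z}^d$ is a function $f:D\to\mathbb{Z}$ with $|f(u)-f(v)|\le\|u-v\|_1$ and $f(v)\equiv\|v\|_1\pmod 2$ for all $u,v\in D$. Restrictions are written $f_\Lambda$. For non-empty finite $\Lambda\subset\mathbb{Z}^d$ and a homomorphism height function $\tau:\partial_\circ\Lambda\to\mathbb{Z}$, $\mu^{\Lambda,\tau}$ is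 the uniform probability measure on homomorphism height functions $f:\Lambda^+\to\mathbb{Z}$ with $f\equiv\tau$ on $\partial_\circ\Lambda$; $\mu^{\Lambda,0}$ is the case $\tau\equiv0$. A Gibbs measure is a probability measure $\mu$ on homomorphism height functions on $\mathbb{Z}^d$ such that, for $f$ sampled from $\mu$ and every non-empty finite $\Lambda\subset\mathbb{Z}^d$, the conditional distribution of $f_{\Lambda^+}$ given $f_{\Lambda^c}$ equals $\mu^{\Lambda,\tau}$ with $\tau=f_{\partial_\circ\Lambda}$, almost surely. It is $\mathbb{Z}^d_{\mathrm{even}}$-translation-invariant if it is invariant in distribution under all translations by vectors of $\mathbb{Z}^d_{\mathrm{even}}$. A sequence $\mu^{\Lambda_n,\tau_n}$ with $\Lambda_n$ increasing to $\mathbb{Z}^d$ converges in distribution if, for every finite subset of $\mathbb{Z}^d$, the marginal distributions on that subset (defined for large $n$) converge in distribution. *)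

theory Defs
  imports "HOL-Probability.Probability"
begin

definition norm1 :: "int ^ 'd \<Rightarrow> int" where
  "norm1 v = (\<Sum>i\<in>UNIV. \<bar>v $ i\<bar>)"

definition adjacent :: "int ^ 'd \<Rightarrow> int ^ 'd \<Rightarrow> bool" where
  "adjacent u v \<longleftrightarrow> norm1 (u - v) = 1"

definition even_lattice :: "(int ^ 'd) set" where
  "even_lattice = {v. even (norm1 v)}"

definition ball1 :: "nat \<Rightarrow> (int ^ 'd) set" where
  "ball1 L = {v. norm1 v \<le> int L}"

definition outer_boundary :: "(int ^ 'd) set \<Rightarrow> (int ^ 'd) set" where
  "outer_boundary \<Lambda> = {v. v \<notin> \<Lambda> \<and> (\<exists>u\<in>\<Lambda>. adjacent u v)}"

definition plus_closure :: "(int ^ 'd) set \<Rightarrow> (int ^ 'd) set" where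
  "plus_closure \<Lambda> = \<Lambda> \<union> outer_boundary \<Lambda>"

text \<open>A function with domain \<open>D\<close> is a total function that is \<open>undefined\<close> off \<open>D\<close>, so that
  it is determined by its values on \<open>D\<close>.\<close>

definition hom_height :: "(int ^ 'd) set \<Rightarrow> (int ^ 'd \<Rightarrow> int) set" where
  "hom_height D = {f \<in> extensional D.
     (\<forall>u\<in>D. \<forall>v\<in>D. \<bar>f u - f v\<bar> \<le> norm1 (u - v)) \<and>
     (\<forall>v\<in>D. f v mod 2 = norm1 v mod 2)}"

text \<open>Only the values of \<open>\<tau>\<close> on the outer boundary matter. For a finite \<open>\<Lambda>\<close> and a
  \<open>\<tau>\<close> that is a homomorphism height function on the boundary, the set below is finite and
  non-empty, so this is its uniform distribution.\<close>

definition finite_volume :: "(int ^ 'd) set \<Rightarrow> (int ^ 'd \<Rightarrow> int) \<Rightarrow> (int ^ 'd \<Rightarrow> int) pmf" where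
  "finite_volume \<Lambda> \<tau> =
     pmf_of_set {f \<in> hom_height (plus_closure \<Lambda>). \<forall>v\<in>outer_boundary \<Lambda>. f v = \<tau> v}"

abbreviation config_space :: "(int ^ 'd) set \<Rightarrow> (int ^ 'd \<Rightarrow> int) measure" where
  "config_space D \<equiv> PiM D (\<lambda>_. count_space UNIV)"

definition sigma_restrict ::
    "(int ^ 'd \<Rightarrow> int) measure \<Rightarrow> (int ^ 'd) set \<Rightarrow> (int ^ 'd \<Rightarrow> int) measure" where
  "sigma_restrict \<mu> D = vimage_algebra (space \<mu>) (\<lambda>f. restrict f D) (config_space D)"

text \<open>The null set in the DLR condition may depend on the event \<open>A\<close>, as for any version of a
  conditional probability; since there are only countably many configurations on
  \<open>plus_closure \<Lambda>\<close>, this determines the conditional distribution almost surely.\<close>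

definition gibbs_measure :: "(int ^ 'd \<Rightarrow> int) measure \<Rightarrow> bool" where
  "gibbs_measure \<mu> \<longleftrightarrow>
     prob_space \<mu> \<and>
     sets \<mu> = sets (restrict_space (config_space UNIV) (hom_height UNIV)) \<and>
     (\<forall>\<Lambda>. finite \<Lambda> \<longrightarrow> \<Lambda> \<noteq> {} \<longrightarrow>
       (\<forall>A \<in> sets (config_space (plus_closure \<Lambda>)).
         AE f in \<mu>.
           real_cond_exp \<mu> (sigma_restrict \<mu> (- \<Lambda>))
             (\<lambda>h. indicator A (restrict h (plus_closure \<Lambda>))) f =
           measure_pmf.prob (finite_volume \<Lambda> (restrict f (outer_boundary \<Lambda>))) A))"

definition even_translation_invariant :: "(int ^ 'd \<Rightarrow> int) measure \<Rightarrow> bool" where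
  "even_translation_invariant \<mu> \<longleftrightarrow>
     (\<forall>w\<in>even_lattice. distr \<mu> \<mu> (\<lambda>f v. f (v + w)) = \<mu>)"

text \<open>Weak convergence of all finite-dimensional marginals. Configurations on a finite \<open>D\<close>
  form a countable discrete space, so the bounded continuous test functions are all bounded
  functions. If the domains of the configurations under \<open>P n\<close> increase to the whole lattice,
  then they contain \<open>D\<close> for large \<open>n\<close>; the finitely many \<open>n\<close> for which they do not are
  irrelevant to the limit.\<close>

definition converges_in_distribution ::
    "(nat \<Rightarrow> (int ^ 'd \<Rightarrow> int) pmf) \<Rightarrow> (int ^ 'd \<Rightarrow> int) measure \<Rightarrow> bool" where
  "converges_in_distribution P \<mu> \<longleftrightarrow>
     (\<forall>D. finite D \<longrightarrow> (\<forall>g :: (int ^ 'd \<Rightarrow> int) \<Rightarrow> real. bounded (range g) \<longrightarrow>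
       (\<lambda>n. \<integral>f. g f \<partial>measure_pmf (map_pmf (\<lambda>f. restrict f D) (P n)))
         \<longlonglongrightarrow> (\<integral>f. g f \<partial>distr \<mu> (config_space D) (\<lambda>f. restrict f D))))"

end

(*
  Given |f|, the signs of f form a finite abelian group V(A) that depends only on the set A of even
  vertices where f does not vanish, and |V(A)| |V(B)| <= |V(A Int B)| |V(A Un B)|. Hence the weights of
  |f|, also those twisted by a product of signs of f, satisfy the lattice condition of the four
  functions theorem. So psi(|f|) prod_{v in S} sgn f(v), with psi >= 0 increasing, is negatively
  correlated with the vanishing of f on a given set, and its expectation with zero boundary
  conditions increases with the domain. Indicators of local events are linear combinations of such
  functions, whence all local probabilities converge along every exhaustion by domains with even
  boundary. Tightness at the origin prevents loss of mass; the limit inherits the DLR equations, and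
  it is invariant under even translations since a translated exhaustion is again one.
*)

theory Submission
  imports Defs
begin

section \<open>Four functions theorem\<close>

text \<open>Zeros of f occur at even vertices only. The even vertices where f does not vanish glue
  the odd vertices into clusters, and each cluster inside the domain has a free sign. So the group
  of signs has 2^k elements, k being the number of clusters, as in the random-cluster picture of the
  Ising model, and the inequality for its order is supermodularity of the cluster count. Passing to
  |f| is forced, because vanishing on a set is a decreasing event for |f| but not a monotone one for
  f. The law of |f| does not determine that of f, whence the twist by products of signs. Such a
  product is a character of the sign group: where f does not vanish on S its average is 0 or 1, and
  it can only switch from 0 to 1 as more even vertices become non-zero. That is why the twist keeps
  the lattice condition. The limit is taken over all even domains directed by inclusion, since a
  translated ball is no longer a centred ball but still an even domain.\<close>

lemma four_functions_two_point:
  fixes a\<^sub>0 a\<^sub>1 b\<^sub>0 b\<^sub>1 c\<^sub>0 c\<^sub>1 d\<^sub>0 d\<^sub>1 :: real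
  assumes nn: "0 \<le> a\<^sub>0" "0 \<le> a\<^sub>1" "0 \<le> b\<^sub>0" "0 \<le> b\<^sub>1" "0 \<le> c\<^sub>0" "0 \<le> c\<^sub>1" "0 \<le> d\<^sub>0" "0 \<le> d\<^sub>1"
    and le: "a\<^sub>0 * b\<^sub>0 \<le> c\<^sub>0 * d\<^sub>0" "a\<^sub>0 * b\<^sub>1 \<le> c\<^sub>1 * d\<^sub>0" "a\<^sub>1 * b\<^sub>0 \<le> c\<^sub>1 * d\<^sub>0" "a\<^sub>1 * b\<^sub>1 \<le> c\<^sub>1 * d\<^sub>1"
  shows "(a\<^sub>0 + a\<^sub>1) * (b\<^sub>0 + b\<^sub>1) \<le> (c\<^sub>0 + c\<^sub>1) * (d\<^sub>0 + d\<^sub>1)"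
proof (cases "c\<^sub>1 * d\<^sub>0 = 0")
  case True
  have "a\<^sub>0 * b\<^sub>1 = 0" "a\<^sub>1 * b\<^sub>0 = 0"
    using True le nn by (metis antisym_conv mult_nonneg_nonneg)+
  moreover have "0 \<le> c\<^sub>0 * d\<^sub>1" using nn by simp
  ultimately show ?thesis using le True unfolding ring_distribs by linarith
next
  case False
  define m where "m = c\<^sub>1 * d\<^sub>0"
  have m: "m > 0" using False nn by (simp add: m_def less_le)
  \<comment> \<open>With \<open>m\<close> bounding both cross products x and y, (m - x)(m - y) \<ge>
    0 gives x + y \<le> m + xy/m; the product of the two diagonal bounds shows that xy/m is at most
    \<open>c\<^sub>0 * d\<^sub>1\<close>.\<close>
  have "0 \<le> (m - a\<^sub>0 * b\<^sub>1) * (m - a\<^sub>1 * b\<^sub>0)"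
    using le by (simp add: m_def)
  moreover have "(a\<^sub>0 * b\<^sub>0) * (a\<^sub>1 * b\<^sub>1) \<le> (c\<^sub>0 * d\<^sub>0) * (c\<^sub>1 * d\<^sub>1)"
    using nn by (intro mult_mono[OF le(1) le(4)]) auto
  ultimately have "m * (a\<^sub>0 * b\<^sub>1 + a\<^sub>1 * b\<^sub>0) \<le> m * (m + c\<^sub>0 * d\<^sub>1)"
    by (simp add: m_def algebra_simps)
  then have "a\<^sub>0 * b\<^sub>1 + a\<^sub>1 * b\<^sub>0 \<le> m + c\<^sub>0 * d\<^sub>1"
    using m by simp
  then show ?thesis using le by (simp add: m_def algebra_simps)
qed

lemma sum_Pow_insert:
  assumes "finite X" "x \<notin> X"
  shows "sum f (Pow (insert x X)) = (\<Sum>A\<in>Pow X. f A + f (insert x A))"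
proof -
  have "sum f (Pow (insert x X)) = sum f (Pow X) + sum f (insert x ` Pow X)"
    using assms by (subst Pow_insert, intro sum.union_disjoint) auto
  also have "sum f (insert x ` Pow X) = (\<Sum>A\<in>Pow X. f (insert x A))"
    using assms by (subst sum.reindex) (auto simp: inj_on_def)
  finally show ?thesis by (simp add: sum.distrib)
qed

text \<open>The Ahlswede-Daykin inequality. Removing a point x replaces each of the four functions
  by the sum of its values at A and at \<open>insert x A\<close>; the hypothesis for these sums is
  the two-point inequality, with index 1 recording membership of x.\<close>

lemma four_functions_Pow:
  fixes \<alpha> \<beta> \<gamma> \<delta> :: "'a set \<Rightarrow> real"
  assumes "finite X"
    and nn: "\<And>A. A \<subseteq> X \<Longrightarrow> 0 \<le> \<alpha> A \<and> 0 \<le> \<beta> A \<and> 0 \<le> \<gamma> A \<and> 0 \<le> \<delta> A"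
    and le: "\<And>A B. A \<subseteq> X \<Longrightarrow> B \<subseteq> X \<Longrightarrow> \<alpha> A * \<beta> B \<le> \<gamma> (A \<union> B) * \<delta> (A \<inter> B)"
  shows "sum \<alpha> (Pow X) * sum \<beta> (Pow X) \<le> sum \<gamma> (Pow X) * sum \<delta> (Pow X)"
  using assms
proof (induction X arbitrary: \<alpha> \<beta> \<gamma> \<delta> rule: finite_induct)
  case empty
  then show ?case by simp
next
  case (insert x X)
  have "sum (\<lambda>A. \<alpha> A + \<alpha> (insert x A)) (Pow X) * sum (\<lambda>A. \<beta> A + \<beta> (insert x A)) (Pow X)
      \<le> sum (\<lambda>A. \<gamma> A + \<gamma> (insert x A)) (Pow X) * sum (\<lambda>A. \<delta> A + \<delta> (insert x A)) (Pow X)"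
  proof (rule insert.IH)
    fix A assume A: "A \<subseteq> X"
    then have "A \<subseteq> insert x X" "insert x A \<subseteq> insert x X" by auto
    from this[THEN insert.prems(1)]
    show "0 \<le> \<alpha> A + \<alpha> (insert x A) \<and> 0 \<le> \<beta> A + \<beta> (insert x A) \<and>
        0 \<le> \<gamma> A + \<gamma> (insert x A) \<and> 0 \<le> \<delta> A + \<delta> (insert x A)"
      by simp
    fix B assume B: "B \<subseteq> X"
    have sub: "C \<subseteq> insert x X" "insert x C \<subseteq> insert x X" if "C \<subseteq> X" for C
      using that by auto
    have x: "x \<notin> A" "x \<notin> B" using A B insert.hyps by auto
    note s = sub[OF A] sub[OF B]
    have AB: "A \<union> B \<subseteq> X" "A \<inter> B \<subseteq> X" using A B by auto
    show "(\<alpha> A + \<alpha> (insert x A)) * (\<beta> B + \<beta> (insert x B))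
        \<le> (\<gamma> (A \<union> B) + \<gamma> (insert x (A \<union> B))) * (\<delta> (A \<inter> B) + \<delta> (insert x (A \<inter> B)))"
      using insert.prems(2)[OF s(1) s(3)] insert.prems(2)[OF s(1) s(4)]
        insert.prems(2)[OF s(2) s(3)] insert.prems(2)[OF s(2) s(4)] x
        insert.prems(1)[OF s(1)] insert.prems(1)[OF s(2)] insert.prems(1)[OF s(3)]
        insert.prems(1)[OF s(4)] insert.prems(1)[OF sub(1)[OF AB(1)]]
        insert.prems(1)[OF sub(2)[OF AB(1)]] insert.prems(1)[OF sub(1)[OF AB(2)]]
        insert.prems(1)[OF sub(2)[OF AB(2)]]
      by (intro four_functions_two_point) simp_all
  qed
  then show ?case
    using insert.hyps by (simp add: sum_Pow_insert)
qed

text \<open>A finite lattice of functions embeds into a power set by sending a to the region under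
  its graph, which turns \<open>sup\<close> and \<open>inf\<close> into union and intersection.
  Non-negativity and agreement off \<Lambda> make the embedding injective.\<close>

lemma four_functions:
  fixes H :: "('a \<Rightarrow> int) set" and \<alpha> \<beta> \<gamma> \<delta> :: "('a \<Rightarrow> int) \<Rightarrow> real"
  assumes fin: "finite H" "finite \<Lambda>"
    and off: "\<And>a b v. a \<in> H \<Longrightarrow> b \<in> H \<Longrightarrow> v \<notin> \<Lambda> \<Longrightarrow> a v = b v"
    and pos: "\<And>a v. a \<in> H \<Longrightarrow> 0 \<le> a v"
    and closed: "\<And>a b. a \<in> H \<Longrightarrow> b \<in> H \<Longrightarrow> sup a b \<in> H \<and> inf a b \<in> H"
    and nn: "\<And>a. a \<in> H \<Longrightarrow> 0 \<le> \<alpha> a \<and> 0 \<le> \<beta> a \<and> 0 \<le> \<gamma> a \<and> 0 \<le> \<delta> a"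
    and le: "\<And>a b. a \<in> H \<Longrightarrow> b \<in> H \<Longrightarrow> \<alpha> a * \<beta> b \<le> \<gamma> (sup a b) * \<delta> (inf a b)"
  shows "sum \<alpha> H * sum \<beta> H \<le> sum \<gamma> H * sum \<delta> H"
proof -
  define \<iota> where "\<iota> a = {(v, k). v \<in> \<Lambda> \<and> 0 \<le> k \<and> k < (a v :: int)}" for a
  define X where "X = (\<Union>a\<in>H. \<iota> a)"
  have "\<iota> a = (SIGMA v:\<Lambda>. {0..<a v})" for a
    by (auto simp: \<iota>_def)
  then have finX: "finite X"
    using fin by (auto simp: X_def)
  have inj: "inj_on \<iota> H"
  proof (rule inj_onI, rule ext)
    fix a b v assume H: "a \<in> H" "b \<in> H" and eq: "\<iota> a = \<iota> b"
    show "a v = b v"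
    proof (cases "v \<in> \<Lambda>")
      case True
      then have "{0..<a v} = {0..<b v}"
        using eq by (auto simp: \<iota>_def set_eq_iff)
      then have "card {0..<a v} = card {0..<b v}" by simp
      then show ?thesis using pos[OF H(1), of v] pos[OF H(2), of v] by simp
    qed (use off H in blast)
  qed
  have \<iota>_sup: "\<iota> (sup a b) = \<iota> a \<union> \<iota> b" and \<iota>_inf: "\<iota> (inf a b) = \<iota> a \<inter> \<iota> b" for a b
    by (auto simp: \<iota>_def sup_int_def inf_int_def)
  \<comment> \<open>Off the image of the embedding all four functions are set to 0. The left-hand
    side of the inequality then vanishes unless both sets lie in the image, and the sums do not
    change.\<close>
  define ext where "ext \<phi> A = (if A \<in> \<iota> ` H then \<phi> (the_inv_into H \<iota> A) else 0)"
    for \<phi> :: "('a \<Rightarrow> int) \<Rightarrow> real" and A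
  have ext_\<iota>: "ext \<phi> (\<iota> a) = \<phi> a" if "a \<in> H" for \<phi> a
    using that inj by (simp add: ext_def the_inv_into_f_f)
  have ext_sum: "sum (ext \<phi>) (Pow X) = sum \<phi> H" for \<phi>
  proof -
    have "sum (ext \<phi>) (Pow X) = sum (ext \<phi>) (\<iota> ` H)"
      using finX by (intro sum.mono_neutral_right) (auto simp: X_def ext_def)
    also have "\<dots> = sum \<phi> H"
      using inj by (subst sum.reindex) (auto simp: ext_\<iota>)
    finally show ?thesis .
  qed
  have "sum (ext \<alpha>) (Pow X) * sum (ext \<beta>) (Pow X) \<le> sum (ext \<gamma>) (Pow X) * sum (ext \<delta>) (Pow X)"
  proof (rule four_functions_Pow[OF finX])
    have nn_ext: "0 \<le> ext \<phi> A" if "\<And>a. a \<in> H \<Longrightarrow> 0 \<le> \<phi> a" for \<phi> A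
      using that by (cases "A \<in> \<iota> ` H") (auto simp: ext_\<iota>, simp add: ext_def)
    then show nn': "0 \<le> ext \<alpha> A \<and> 0 \<le> ext \<beta> A \<and> 0 \<le> ext \<gamma> A \<and> 0 \<le> ext \<delta> A" for A
      using nn by simp
    fix A B
    show "ext \<alpha> A * ext \<beta> B \<le> ext \<gamma> (A \<union> B) * ext \<delta> (A \<inter> B)"
    proof (cases "A \<in> \<iota> ` H \<and> B \<in> \<iota> ` H")
      case True
      then obtain a b where "a \<in> H" "b \<in> H" "A = \<iota> a" "B = \<iota> b" by auto
      then show ?thesis
        using le[of a b] closed[of a b] by (simp add: ext_\<iota> flip: \<iota>_sup \<iota>_inf)
    next
      case False
      then have "ext \<alpha> A * ext \<beta> B = 0" by (auto simp: ext_def)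
      moreover have "0 \<le> ext \<gamma> (A \<union> B) * ext \<delta> (A \<inter> B)" using nn' by simp
      ultimately show ?thesis by linarith
    qed
  qed
  then show ?thesis by (simp add: ext_sum)
qed

section \<open>The lattice and height functions\<close>

lemma norm1_nonneg: "0 \<le> norm1 v"
  by (simp add: norm1_def sum_nonneg)

lemma norm1_zero [simp]: "norm1 0 = 0"
  by (simp add: norm1_def)

lemma norm1_minus_commute: "norm1 (u - v) = norm1 (v - u)"
  by (simp add: norm1_def abs_minus_commute)

lemma norm1_add_le: "norm1 (u + v) \<le> norm1 u + norm1 v"
  by (simp add: norm1_def abs_triangle_ineq sum_mono flip: sum.distrib)

lemma norm1_uminus [simp]: "norm1 (- v) = norm1 v"
  by (simp add: norm1_def)

lemma norm1_axis: "norm1 (axis i x) = \<bar>x\<bar>"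
  by (simp add: norm1_def axis_def if_distrib cong: if_cong)

lemma even_norm1: "even (norm1 v) \<longleftrightarrow> even (\<Sum>i\<in>UNIV. v $ i)"
proof -
  have "even (sum (\<lambda>i. \<bar>v $ i\<bar>) A) \<longleftrightarrow> even (sum (\<lambda>i. v $ i) A)" for A
    by (induction A rule: infinite_finite_induct) auto
  then show ?thesis by (simp add: norm1_def)
qed

lemma even_norm1_add: "even (norm1 (u + v)) \<longleftrightarrow> (even (norm1 u) \<longleftrightarrow> even (norm1 v))"
  by (simp add: even_norm1 sum.distrib)

lemma even_norm1_diff: "even (norm1 (u - v)) \<longleftrightarrow> (even (norm1 u) \<longleftrightarrow> even (norm1 v))"
  by (simp add: even_norm1 sum_subtractf)

lemma adjacent_commute: "adjacent u v \<longleftrightarrow> adjacent v u"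
  by (simp add: adjacent_def norm1_minus_commute)

lemma adjacent_parity: "adjacent u v \<Longrightarrow> even (norm1 u) \<longleftrightarrow> odd (norm1 v)"
  using even_norm1_diff[of u v] by (auto simp: adjacent_def)

lemma adjacent_axis: "adjacent v (v + axis i 1)"
  by (simp add: adjacent_def norm1_axis)

lemma exists_adjacent_closer:
  assumes "u \<noteq> v"
  obtains w where "adjacent u w" "norm1 (w - v) = norm1 (u - v) - 1"
proof -
  obtain i where i: "u $ i \<noteq> v $ i" using assms by (metis vec_eq_iff)
  define w where "w = u + axis i (sgn (v $ i - u $ i))"
  have "norm1 (u - w) = 1"
    using i by (simp add: w_def norm1_axis abs_sgn_eq)
  moreover have "norm1 (w - v) = norm1 (u - v) - 1"
  proof -
    have "norm1 (w - v) = \<bar>(w - v) $ i\<bar> + (\<Sum>j\<in>UNIV - {i}. \<bar>(w - v) $ j\<bar>)"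
      unfolding norm1_def by (subst sum.remove[of _ i]) auto
    also have "\<bar>(w - v) $ i\<bar> = \<bar>(u - v) $ i\<bar> - 1"
      using i by (auto simp: w_def axis_def sgn_if)
    also have "(\<Sum>j\<in>UNIV - {i}. \<bar>(w - v) $ j\<bar>) = (\<Sum>j\<in>UNIV - {i}. \<bar>(u - v) $ j\<bar>)"
      by (intro sum.cong) (auto simp: w_def axis_def)
    also have "\<bar>(u - v) $ i\<bar> - 1 + (\<Sum>j\<in>UNIV - {i}. \<bar>(u - v) $ j\<bar>) = norm1 (u - v) - 1"
      unfolding norm1_def by (subst (2) sum.remove[of _ i]) auto
    finally show ?thesis .
  qed
  ultimately show ?thesis using that by (auto simp: adjacent_def)
qed

lemma abs_component_le_norm1: "\<bar>v $ i\<bar> \<le> norm1 v"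
  unfolding norm1_def by (intro member_le_sum) auto

lemma finite_ball1: "finite (ball1 L :: (int ^ 'd) set)"
proof -
  have "ball1 L \<subseteq> (\<lambda>g. \<chi> i. g i) ` (UNIV \<rightarrow>\<^sub>E {- int L..int L} :: ('d \<Rightarrow> int) set)"
  proof
    fix v :: "int ^ 'd" assume "v \<in> ball1 L"
    then have "\<bar>v $ i\<bar> \<le> int L" for i
      using abs_component_le_norm1[of v i] by (simp add: ball1_def)
    then have "- int L \<le> v $ i \<and> v $ i \<le> int L" for i
      by (simp add: abs_le_iff minus_le_iff)
    then have "(\<lambda>i. v $ i) \<in> UNIV \<rightarrow>\<^sub>E {- int L..int L}"
      by auto
    then show "v \<in> (\<lambda>g. \<chi> i. g i) ` (UNIV \<rightarrow>\<^sub>E {- int L..int L})"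
      by (rule rev_image_eqI) simp
  qed
  then show ?thesis by (rule finite_subset) (auto intro!: finite_PiE)
qed

lemma finite_subset_ball1:
  assumes "finite K"
  obtains N where "\<And>n. N \<le> n \<Longrightarrow> K \<subseteq> ball1 n"
proof (rule that)
  fix n assume n: "nat (\<Sum>v\<in>K. norm1 v) \<le> n"
  show "K \<subseteq> ball1 n"
  proof
    fix v assume "v \<in> K"
    then have "norm1 v \<le> (\<Sum>v\<in>K. norm1 v)"
      using assms by (intro member_le_sum) (auto simp: norm1_nonneg)
    then show "v \<in> ball1 n" using n by (simp add: ball1_def)
  qed
qed

lemma infinite_UNIV_int_vec: "infinite (UNIV :: (int ^ 'd) set)"
proof -
  have "inj (\<lambda>n. (\<chi> i. n) :: int ^ 'd)"
    by (auto intro!: injI simp: vec_eq_iff)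
  then show ?thesis
    using finite_imageD infinite_UNIV_int by (metis finite_subset subset_UNIV)
qed

text \<open>\<open>norm1 (u - v)\<close> is the graph distance, so the bound is the sum of the unit
  bounds along a path that approaches v.\<close>

lemma Lipschitz_norm1:
  fixes f :: "int ^ 'd \<Rightarrow> int"
  assumes "\<And>u v. adjacent u v \<Longrightarrow> \<bar>f u - f v\<bar> \<le> 1"
  shows "\<bar>f u - f v\<bar> \<le> norm1 (u - v)"
proof (induction "nat (norm1 (u - v))" arbitrary: u)
  case 0
  then have "norm1 (u - v) = 0" using norm1_nonneg[of "u - v"] by simp
  then have "u = v"
    by (metis exists_adjacent_closer norm1_nonneg diff_0 neg_0_le_iff_le not_one_le_zero)
  then show ?case by simp
next
  case (Suc n)
  then have "u \<noteq> v" by auto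
  then obtain w where w: "adjacent u w" "norm1 (w - v) = norm1 (u - v) - 1"
    by (rule exists_adjacent_closer)
  have "n = nat (norm1 (w - v))"
    using Suc.hyps(2) w(2) by linarith
  then have "\<bar>f w - f v\<bar> \<le> norm1 (w - v)"
    by (rule Suc.hyps(1))
  then show ?case using assms[OF w(1)] w(2) by linarith
qed

lemma hom_height_UNIV_iff:
  "f \<in> hom_height UNIV \<longleftrightarrow>
    (\<forall>u v. adjacent u v \<longrightarrow> \<bar>f u - f v\<bar> \<le> 1) \<and> (\<forall>v. even (f v) \<longleftrightarrow> even (norm1 v))"
proof -
  have *: "x mod 2 = y mod 2 \<longleftrightarrow> (even x \<longleftrightarrow> even y)" for x y :: int
    by presburger
  show ?thesis
    unfolding hom_height_def * using Lipschitz_norm1[of f]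
    by (auto simp: adjacent_def) (metis order_refl)
qed

text \<open>Every edge has exactly one even endpoint, which may be named v; the constructions below
  often split on the value at that endpoint.\<close>

lemma hom_height_UNIV_I:
  assumes "\<And>u v. adjacent u v \<Longrightarrow> even (norm1 v) \<Longrightarrow> \<bar>f u - f v\<bar> \<le> 1"
    and "\<And>v. even (f v) \<longleftrightarrow> even (norm1 v)"
  shows "f \<in> hom_height UNIV"
  unfolding hom_height_UNIV_iff
  using assms by (metis abs_minus_commute adjacent_commute adjacent_parity)

lemma hom_height_sgn_eq:
  assumes "f \<in> hom_height UNIV" "adjacent u v" "f u \<noteq> 0" "f v \<noteq> 0"
  shows "sgn (f u) = sgn (f v)"
proof -
  have "\<bar>f u - f v\<bar> \<le> 1" "even (f u) \<noteq> even (f v)"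
    using assms adjacent_parity[of u v] by (auto simp: hom_height_UNIV_iff)
  then show ?thesis using assms(3,4) by (auto simp: sgn_if)
qed

text \<open>Configurations on \<open>\<Lambda>\<close> are extended to the whole lattice by the flat function, so that all
  volumes share one space of configurations.\<close>

definition zero_homs :: "(int ^ 'd) set \<Rightarrow> (int ^ 'd \<Rightarrow> int) set" where
  "zero_homs \<Lambda> = {f \<in> hom_height UNIV. \<forall>v. v \<notin> \<Lambda> \<longrightarrow> f v = norm1 v mod 2}"

text \<open>Only odd vertices of \<open>\<Lambda>\<close> can have neighbours outside, so the outer
  boundary is even and the value 0 on it respects parity. There it coincides with the flat extension
  used by \<open>zero_homs\<close>.\<close>

definition even_domain :: "(int ^ 'd) set \<Rightarrow> bool" where
  "even_domain \<Lambda> \<longleftrightarrow> finite \<Lambda> \<and> (\<forall>u\<in>\<Lambda>. \<forall>v. adjacent u v \<longrightarrow> even (norm1 u) \<longrightarrow> v \<in> \<Lambda>)"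

lemma flat_in_zero_homs: "(\<lambda>v. norm1 v mod 2) \<in> zero_homs \<Lambda>"
  unfolding zero_homs_def
proof (intro CollectI conjI hom_height_UNIV_I)
  fix u v :: "int ^ 'a"
  have "0 \<le> norm1 u mod 2" "norm1 u mod 2 < 2" "0 \<le> norm1 v mod 2" "norm1 v mod 2 < 2"
    by auto
  then show "\<bar>norm1 u mod 2 - norm1 v mod 2\<bar> \<le> 1" by linarith
qed auto

lemma zero_homs_nonempty: "zero_homs \<Lambda> \<noteq> {}"
  using flat_in_zero_homs by blast

lemma finite_zero_homs:
  assumes "finite \<Lambda>"
  shows "finite (zero_homs \<Lambda>)"
proof -
  \<comment> \<open>At w the value of f is fixed to 0 or 1, so the Lipschitz condition confines f on
    \<Lambda>; the extra 1 in the intervals accounts for that value.\<close>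
  obtain w where w: "w \<notin> \<Lambda>"
    using assms ex_new_if_finite infinite_UNIV_int_vec by blast
  have "inj_on (\<lambda>f. restrict f \<Lambda>) (zero_homs \<Lambda>)"
  proof (rule inj_onI, rule ext)
    fix f g v assume "f \<in> zero_homs \<Lambda>" "g \<in> zero_homs \<Lambda>" "restrict f \<Lambda> = restrict g \<Lambda>"
    then show "f v = g v"
      by (cases "v \<in> \<Lambda>") (auto simp: zero_homs_def dest: fun_cong[of _ _ v])
  qed
  moreover have "(\<lambda>f. restrict f \<Lambda>) ` zero_homs \<Lambda>
      \<subseteq> (\<Pi>\<^sub>E v\<in>\<Lambda>. {- norm1 (v - w) - 1..norm1 (v - w) + 1})"
  proof (intro image_subsetI restrict_PiE_iff[THEN iffD2] ballI)
    fix f v assume f: "f \<in> zero_homs \<Lambda>"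
    have "\<bar>f v - f w\<bar> \<le> norm1 (v - w)"
      using f unfolding zero_homs_def hom_height_def by blast
    moreover have "f w = norm1 w mod 2"
      using f w by (simp add: zero_homs_def)
    moreover have "0 \<le> norm1 w mod 2" "norm1 w mod 2 < 2" by auto
    ultimately show "f v \<in> {- norm1 (v - w) - 1..norm1 (v - w) + 1}"
      by (auto simp: abs_le_iff)
  qed
  ultimately show ?thesis
    using assms by (meson finite_PiE finite_atLeastAtMost_int finite_imageD finite_subset)
qed

lemma abs_in_zero_homs:
  assumes "f \<in> zero_homs \<Lambda>"
  shows "(\<lambda>v. \<bar>f v\<bar>) \<in> zero_homs \<Lambda>"
proof -
  have "\<bar>\<bar>x\<bar> - \<bar>y\<bar>\<bar> \<le> 1" if "\<bar>x - y\<bar> \<le> 1" for x y :: int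
    using that by linarith
  then show ?thesis
    using assms by (auto simp: zero_homs_def hom_height_UNIV_iff)
qed

lemma sup_inf_in_zero_homs:
  assumes "f \<in> zero_homs \<Lambda>" "g \<in> zero_homs \<Lambda>"
  shows "sup f g \<in> zero_homs \<Lambda> \<and> inf f g \<in> zero_homs \<Lambda>"
proof -
  have "\<bar>max x x' - max y y'\<bar> \<le> 1" "\<bar>min x x' - min y y'\<bar> \<le> 1"
    if "\<bar>x - y\<bar> \<le> 1" "\<bar>x' - y'\<bar> \<le> 1" for x y x' y' :: int
    using that by linarith+
  moreover have "even (max x y) \<longleftrightarrow> P" "even (min x y) \<longleftrightarrow> P"
    if "even x \<longleftrightarrow> P" "even y \<longleftrightarrow> P" for x y :: int and P
    using that by (auto simp: max_def min_def)
  ultimately show ?thesis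
    using assms by (simp add: zero_homs_def hom_height_UNIV_iff sup_int_def inf_int_def)
qed

section \<open>Signs given absolute values\<close>

text \<open>For groups of exponent two, |V| |W| = |VW| |V \<inter> W|. Concretely, each product u
  gets one chosen factorization u = r t' with r = \<open>\<sigma> u\<close> in V and t' in W; the
  pair (s, t) is recovered from u = s t and from s r, which lies in both V and W.\<close>

lemma card_mult_le_card_Int:
  fixes V W U :: "('a \<Rightarrow> int) set"
  assumes fin: "finite U" "finite V" "finite W"
    and sq: "\<And>s v. s \<in> V \<union> W \<Longrightarrow> s v * s v = 1"
    and V: "\<And>s t. s \<in> V \<Longrightarrow> t \<in> V \<Longrightarrow> (\<lambda>v. s v * t v) \<in> V"
    and W: "\<And>s t. s \<in> W \<Longrightarrow> t \<in> W \<Longrightarrow> (\<lambda>v. s v * t v) \<in> W"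
    and U: "\<And>s t. s \<in> V \<Longrightarrow> t \<in> W \<Longrightarrow> (\<lambda>v. s v * t v) \<in> U"
  shows "card V * card W \<le> card U * card (V \<inter> W)"
proof -
  let ?m = "\<lambda>s t v. s v * t v :: int"
  define \<sigma> where "\<sigma> u = (SOME s. s \<in> V \<and> (\<exists>t\<in>W. ?m s t = u))" for u
  define \<phi> where "\<phi> = (\<lambda>(s, t). (?m s t, ?m s (\<sigma> (?m s t))))"
  have \<sigma>: "\<sigma> (?m s t) \<in> V \<and> (\<exists>t'\<in>W. ?m (\<sigma> (?m s t)) t' = ?m s t)" if "s \<in> V" "t \<in> W" for s t
    unfolding \<sigma>_def by (rule someI[of _ s]) (use that in blast)
  have "inj_on \<phi> (V \<times> W)"
  proof (rule inj_onI, clarify)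
    fix s t s' t' assume st: "s \<in> V" "t \<in> W" "s' \<in> V" "t' \<in> W" and eq: "\<phi> (s, t) = \<phi> (s', t')"
    have m: "?m s t = ?m s' t'" and ms: "?m s (\<sigma> (?m s t)) = ?m s' (\<sigma> (?m s t))"
      using eq by (auto simp: \<phi>_def)
    have "s v = s' v" for v
      using fun_cong[OF ms, of v] \<sigma>[OF st(1,2)] sq[of "\<sigma> (?m s t)" v] by auto
    then have "s = s'" by auto
    moreover have "t v = t' v" for v
      using fun_cong[OF m, of v] \<open>s = s'\<close> sq[of s v] st by auto
    ultimately show "s = s' \<and> t = t'" by auto
  qed
  moreover have "\<phi> ` (V \<times> W) \<subseteq> U \<times> (V \<inter> W)"
  proof clarify
    fix s t a b assume st: "s \<in> V" "t \<in> W" and ab: "(a, b) = \<phi> (s, t)"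
    obtain t' where t': "t' \<in> W" "?m (\<sigma> (?m s t)) t' = ?m s t"
      using \<sigma>[OF st] by blast
    define r where "r = \<sigma> (?m s t)"
    have r: "r \<in> V" using \<sigma>[OF st] by (simp add: r_def)
    \<comment> \<open>From r t' = s t, and since all squares are 1, s r = t t'. The left side
      belongs to V, the right side to W.\<close>
    have "s v * r v = t v * t' v" for v
    proof -
      have "s v * r v = s v * (r v * t' v) * t' v"
        using sq[of t' v] t' by (simp add: mult.assoc)
      also have "\<dots> = s v * (s v * t v) * t' v"
        using fun_cong[OF t'(2), of v] by (simp add: r_def)
      also have "\<dots> = t v * t' v"
        using sq[of s v] st by (simp flip: mult.assoc)
      finally show ?thesis .
    qed
    then have "?m s r = ?m t t'" by auto
    moreover have "?m t t' \<in> W" "?m s r \<in> V" "?m s t \<in> U"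
      using V W U st t' r by auto
    ultimately show "a \<in> U \<and> b \<in> V \<inter> W"
      using ab by (simp add: \<phi>_def r_def)
  qed
  ultimately have "card (V \<times> W) \<le> card (U \<times> (V \<inter> W))"
    using fin by (intro card_inj_on_le) auto
  then show ?thesis by (simp add: card_cartesian_product)
qed

text \<open>Orthogonality for a sign-valued character: multiplication by some r with \<psi> r = -1
  permutes V and negates the sum.\<close>

lemma sum_character:
  fixes V :: "('a \<Rightarrow> int) set" and \<psi> :: "('a \<Rightarrow> int) \<Rightarrow> int"
  assumes sq: "\<And>s v. s \<in> V \<Longrightarrow> s v * s v = 1"
    and V: "\<And>s t. s \<in> V \<Longrightarrow> t \<in> V \<Longrightarrow> (\<lambda>v. s v * t v) \<in> V"
    and \<psi>: "\<And>s. s \<in> V \<Longrightarrow> \<psi> s \<in> {1, - 1}"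
    and hom: "\<And>s t. s \<in> V \<Longrightarrow> t \<in> V \<Longrightarrow> \<psi> (\<lambda>v. s v * t v) = \<psi> s * \<psi> t"
  shows "(\<Sum>s\<in>V. \<psi> s) = (if \<forall>s\<in>V. \<psi> s = 1 then int (card V) else 0)"
proof (cases "\<forall>s\<in>V. \<psi> s = 1")
  case False
  then obtain r where r: "r \<in> V" "\<psi> r = - 1" using \<psi> by blast
  have inv: "s v * r v * r v = s v" for s :: "'a \<Rightarrow> int" and v
    using sq[OF r(1), of v] by (simp add: mult.assoc)
  have "(\<Sum>s\<in>V. \<psi> s) = (\<Sum>s\<in>V. \<psi> (\<lambda>v. s v * r v))"
    by (rule sum.reindex_bij_witness[of _ "\<lambda>s v. s v * r v" "\<lambda>s v. s v * r v"])
      (auto simp: inv V r)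
  also have "\<dots> = - (\<Sum>s\<in>V. \<psi> s)"
    using hom r by (simp add: sum_negf)
  finally have "(\<Sum>s\<in>V. \<psi> s) = 0" by simp
  then show ?thesis using False by auto
qed auto

text \<open>Given \<open>\<bar>f\<bar>\<close>, the signs of \<open>f\<close> are determined by those at odd vertices, where \<open>f\<close> does not
  vanish, and they are constrained only by having to agree on all neighbours of an even vertex
  at which \<open>f\<close> does not vanish.\<close>

definition odd_repr :: "int ^ 'd \<Rightarrow> int ^ 'd" where
  "odd_repr v = (if odd (norm1 v) then v else v + axis undefined 1)"

text \<open>Fixing the value 1 off the odd vertices of \<Lambda> makes the set finite for finite
  \<Lambda> and still closed under pointwise products. It also matches the positive sign of the flat
  extension outside \<Lambda>.\<close>

definition sign_group :: "(int ^ 'd) set \<Rightarrow> (int ^ 'd) set \<Rightarrow> (int ^ 'd \<Rightarrow> int) set" where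
  "sign_group \<Lambda> A = {s. (\<forall>v. s v \<in> {1, - 1}) \<and> (\<forall>v. v \<notin> \<Lambda> \<or> even (norm1 v) \<longrightarrow> s v = 1) \<and>
     (\<forall>v\<in>A. \<forall>u. adjacent v u \<longrightarrow> s u = s (odd_repr v))}"

definition pos_even :: "(int ^ 'd \<Rightarrow> int) \<Rightarrow> (int ^ 'd) set" where
  "pos_even a = {v. even (norm1 v) \<and> 0 < a v}"

lemma sign_group_sq: "s \<in> sign_group \<Lambda> A \<Longrightarrow> s v * s v = 1"
proof -
  assume "s \<in> sign_group \<Lambda> A"
  then have "s v = 1 \<or> s v = - 1" by (simp add: sign_group_def)
  then show ?thesis by auto
qed

lemma finite_sign_group:
  assumes "finite \<Lambda>"
  shows "finite (sign_group \<Lambda> A)"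
proof (rule finite_subset)
  show "sign_group \<Lambda> A \<subseteq> {s. \<forall>v. (v \<in> \<Lambda> \<longrightarrow> s v \<in> {1, - 1}) \<and> (v \<notin> \<Lambda> \<longrightarrow> s v = 1)}"
    by (auto simp: sign_group_def)
  show "finite {s :: int ^ 'a \<Rightarrow> int. \<forall>v. (v \<in> \<Lambda> \<longrightarrow> s v \<in> {1, - 1}) \<and> (v \<notin> \<Lambda> \<longrightarrow> s v = 1)}"
    using assms by (intro finite_set_of_finite_funs) auto
qed

lemma sign_group_mult:
  assumes "s \<in> sign_group \<Lambda> A" "t \<in> sign_group \<Lambda> B"
  shows "(\<lambda>v. s v * t v) \<in> sign_group \<Lambda> (A \<inter> B)"
proof -
  have "x * y \<in> {1, - 1}" if "x \<in> {1, - 1}" "y \<in> {1, - 1}" for x y :: int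
    using that by auto
  then show ?thesis using assms by (simp add: sign_group_def) (metis IntE)
qed

lemma sign_group_Un: "sign_group \<Lambda> (A \<union> B) = sign_group \<Lambda> A \<inter> sign_group \<Lambda> B"
  by (auto simp: sign_group_def)

text \<open>The union of constraints gives the intersection of the groups, while a product of
  elements of both satisfies the common constraints only. Such products need not exhaust the group
  of \<open>A \<inter> B\<close> in general, whence an inequality.\<close>

lemma card_sign_group_supermodular:
  assumes "finite \<Lambda>"
  shows "card (sign_group \<Lambda> A) * card (sign_group \<Lambda> B)
    \<le> card (sign_group \<Lambda> (A \<inter> B)) * card (sign_group \<Lambda> (A \<union> B))"
  unfolding sign_group_Un
  using sign_group_mult[of _ \<Lambda> A _ A] sign_group_mult[of _ \<Lambda> B _ B]
  by (intro card_mult_le_card_Int finite_sign_group assms sign_group_mult)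
    (auto dest: sign_group_sq)

lemma adjacent_odd_repr: "even (norm1 v) \<Longrightarrow> adjacent v (odd_repr v)"
  by (simp add: odd_repr_def adjacent_axis)

text \<open>The sign at an even vertex is read off its chosen odd neighbour: where \<open>a\<close>
  vanishes it is immaterial, and elsewhere all neighbours agree. An even vertex where
  \<open>a\<close> does not vanish lies in \<Lambda>, and so do its neighbours because the domain is
  even; hence the inverse map, which records signs only at odd vertices of \<Lambda>, loses
  nothing.\<close>

lemma signed_abs_bij:
  assumes \<Lambda>: "even_domain \<Lambda>" and a: "a \<in> zero_homs \<Lambda>" "\<And>v. 0 \<le> a v"
  shows "bij_betw (\<lambda>s v. s (odd_repr v) * a v) (sign_group \<Lambda> (pos_even a))
    {f \<in> zero_homs \<Lambda>. (\<lambda>v. \<bar>f v\<bar>) = a}"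
proof (rule bij_betw_byWitness[where f' = "\<lambda>f v. if v \<in> \<Lambda> \<and> odd (norm1 v) then sgn (f v) else 1"])
  have odd_pos: "0 < a v" if "odd (norm1 v)" for v
  proof -
    have "a v \<noteq> 0" using that a(1) by (auto simp: zero_homs_def hom_height_UNIV_iff)
    then show ?thesis using a(2)[of v] by simp
  qed
  have off: "a v = norm1 v mod 2" if "v \<notin> \<Lambda>" for v
    using that a(1) by (simp add: zero_homs_def)
  show "\<forall>s\<in>sign_group \<Lambda> (pos_even a).
      (\<lambda>v. if v \<in> \<Lambda> \<and> odd (norm1 v) then sgn (s (odd_repr v) * a v) else 1) = s"
  proof (intro ballI ext)
    fix s v assume s: "s \<in> sign_group \<Lambda> (pos_even a)"
    show "(if v \<in> \<Lambda> \<and> odd (norm1 v) then sgn (s (odd_repr v) * a v) else 1) = s v"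
    proof (cases "v \<in> \<Lambda> \<and> odd (norm1 v)")
      case True
      then have "odd_repr v = v" "0 < a v" "s v \<in> {1, - 1}"
        using odd_pos s by (auto simp: odd_repr_def sign_group_def)
      then show ?thesis using True by (auto simp: sgn_if)
    next
      case False
      then show ?thesis using s by (auto simp: sign_group_def)
    qed
  qed
  show "\<forall>f\<in>{f \<in> zero_homs \<Lambda>. (\<lambda>v. \<bar>f v\<bar>) = a}.
      (\<lambda>v. (if odd_repr v \<in> \<Lambda> \<and> odd (norm1 (odd_repr v)) then sgn (f (odd_repr v)) else 1) * a v) = f"
  proof (intro ballI ext)
    fix f v assume "f \<in> {f \<in> zero_homs \<Lambda>. (\<lambda>v. \<bar>f v\<bar>) = a}"
    then have f: "f \<in> zero_homs \<Lambda>" "f \<in> hom_height UNIV" and fa: "\<And>v. a v = \<bar>f v\<bar>"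
      by (auto simp: zero_homs_def)
    have foff: "f v = norm1 v mod 2" if "v \<notin> \<Lambda>"
      using that f by (simp add: zero_homs_def)
    consider (zero) "f v = 0" | (odd) "odd (norm1 v)" | (even) "f v \<noteq> 0" "even (norm1 v)"
      by blast
    then show "(if odd_repr v \<in> \<Lambda> \<and> odd (norm1 (odd_repr v)) then sgn (f (odd_repr v)) else 1) * a v = f v"
    proof cases
      case zero
      then show ?thesis by (simp add: fa)
    next
      case odd
      then show ?thesis
        using foff by (cases "v \<in> \<Lambda>") (simp_all add: odd_repr_def fa sgn_mult_abs odd_iff_mod_2_eq_one)
    next
      case even
      then have v: "v \<in> \<Lambda>" using foff by auto
      note adj = adjacent_odd_repr[OF even(2)]
      have r: "odd_repr v \<in> \<Lambda>" "odd (norm1 (odd_repr v))"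
        using \<Lambda> v adj even(2) adjacent_parity[OF adj] by (auto simp: even_domain_def)
      have "f (odd_repr v) \<noteq> 0"
        using r(2) odd_pos[of "odd_repr v"] by (auto simp: fa)
      then have "sgn (f (odd_repr v)) = sgn (f v)"
        using hom_height_sgn_eq[OF f(2) adj] even by simp
      then show ?thesis using r by (simp add: fa sgn_mult_abs)
    qed
  qed
  show "(\<lambda>s v. s (odd_repr v) * a v) ` sign_group \<Lambda> (pos_even a)
      \<subseteq> {f \<in> zero_homs \<Lambda>. (\<lambda>v. \<bar>f v\<bar>) = a}"
  proof (intro image_subsetI CollectI conjI)
    fix s assume s: "s \<in> sign_group \<Lambda> (pos_even a)"
    then have pm: "s v \<in> {1, - 1}" for v by (simp add: sign_group_def)
    then have "s v = 1 \<or> s v = - 1" for v by auto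
    then have abs_s: "\<bar>s v * x\<bar> = \<bar>x\<bar>" "even (s v * x) \<longleftrightarrow> even x" for v x
      by (metis abs_minus_cancel mult_1 mult_minus_left, metis even_minus mult_1 mult_minus_left)
    show "(\<lambda>v. \<bar>s (odd_repr v) * a v\<bar>) = a"
      using a(2) by (simp add: abs_s)
    have "(\<lambda>v. s (odd_repr v) * a v) \<in> hom_height UNIV"
    proof (rule hom_height_UNIV_I)
      fix u v :: "int ^ 'a" assume uv: "adjacent u v" "even (norm1 v)"
      have a_uv: "\<bar>a u - a v\<bar> \<le> 1"
        using a(1) uv(1) by (auto simp: zero_homs_def hom_height_UNIV_iff)
      show "\<bar>s (odd_repr u) * a u - s (odd_repr v) * a v\<bar> \<le> 1"
      \<comment> \<open>If \<open>a v\<close> is 0, then \<open>a u\<close> is at most 1 and the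
        sign at u may be arbitrary; otherwise v forces both ends to carry the same sign.\<close>
      proof (cases "a v = 0")
        case True
        then show ?thesis using a_uv by (simp add: abs_s)
      next
        case False
        then have "v \<in> pos_even a"
          using a(2)[of v] uv(2) by (simp add: pos_even_def)
        moreover have "odd_repr u = u"
          using uv adjacent_parity by (auto simp: odd_repr_def)
        ultimately have "s (odd_repr u) = s (odd_repr v)"
          using s uv(1) adjacent_commute[of u v] by (auto simp: sign_group_def)
        then show ?thesis
          using a_uv by (simp add: abs_s flip: right_diff_distrib)
      qed
    next
      show "even (s (odd_repr v) * a v) \<longleftrightarrow> even (norm1 v)" for v
        using a(1) unfolding abs_s by (simp add: zero_homs_def hom_height_UNIV_iff)
    qed
    moreover have "s (odd_repr v) * a v = norm1 v mod 2" if "v \<notin> \<Lambda>" for v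
    proof (cases "even (norm1 v)")
      case True
      then show ?thesis using off[OF that] by simp
    next
      case False
      then show ?thesis using off[OF that] s that by (simp add: sign_group_def odd_repr_def)
    qed
    ultimately show "(\<lambda>v. s (odd_repr v) * a v) \<in> zero_homs \<Lambda>"
      by (simp add: zero_homs_def)
  qed
  show "(\<lambda>f v. if v \<in> \<Lambda> \<and> odd (norm1 v) then sgn (f v) else 1) ` {f \<in> zero_homs \<Lambda>. (\<lambda>v. \<bar>f v\<bar>) = a}
      \<subseteq> sign_group \<Lambda> (pos_even a)"
  proof (intro image_subsetI)
    fix f assume "f \<in> {f \<in> zero_homs \<Lambda>. (\<lambda>v. \<bar>f v\<bar>) = a}"
    then have f: "f \<in> hom_height UNIV" and fa: "\<And>v. a v = \<bar>f v\<bar>"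
      by (auto simp: zero_homs_def)
    have nz: "f v \<noteq> 0" if "odd (norm1 v)" for v
      using odd_pos[OF that] by (simp add: fa)
    have nb: "(if u \<in> \<Lambda> \<and> odd (norm1 u) then sgn (f u) else 1) = sgn (f v)"
      if "v \<in> pos_even a" "adjacent v u" for u v
    proof -
      have v: "even (norm1 v)" "f v \<noteq> 0" using that(1) by (auto simp: pos_even_def fa)
      then have "v \<in> \<Lambda>" using off[of v] fa[of v] by auto
      then have "u \<in> \<Lambda>" "odd (norm1 u)"
        using \<Lambda> that(2) v adjacent_parity[OF that(2)] by (auto simp: even_domain_def)
      then show ?thesis
        using hom_height_sgn_eq[OF f that(2)] v nz by simp
    qed
    have "(if u \<in> \<Lambda> \<and> odd (norm1 u) then sgn (f u) else 1)
        = (if odd_repr v \<in> \<Lambda> \<and> odd (norm1 (odd_repr v)) then sgn (f (odd_repr v)) else 1)"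
      if "v \<in> pos_even a" "adjacent v u" for u v
      using nb[OF that] nb[OF that(1) adjacent_odd_repr] that(1) by (simp add: pos_even_def)
    then show "(\<lambda>v. if v \<in> \<Lambda> \<and> odd (norm1 v) then sgn (f v) else 1) \<in> sign_group \<Lambda> (pos_even a)"
      using nz by (auto simp: sign_group_def sgn_if)
  qed
qed

text \<open>For \<open>S = {}\<close> this counts the f with absolute value a, which is the
  unnormalised weight of |f|; a general S twists that count by a product of signs.\<close>

definition sign_weight ::
    "(int ^ 'd) set \<Rightarrow> (int ^ 'd) set \<Rightarrow> (int ^ 'd \<Rightarrow> int) \<Rightarrow> int" where
  "sign_weight \<Lambda> S a = (\<Sum>f | f \<in> zero_homs \<Lambda> \<and> (\<lambda>v. \<bar>f v\<bar>) = a. \<Prod>v\<in>S. sgn (f v))"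

text \<open>Given a, the product of signs over S is a character of the sign group, so it sums to the
  group order or to 0. A zero of a in S kills the sum as well, since
  \<open>sgn 0 = 0\<close>.\<close>

lemma sign_weight_eq:
  assumes "even_domain \<Lambda>" "finite S" "a \<in> zero_homs \<Lambda>" "\<And>v. 0 \<le> a v"
  shows "sign_weight \<Lambda> S a =
    (if (\<forall>v\<in>S. 0 < a v) \<and> (\<forall>s\<in>sign_group \<Lambda> (pos_even a). (\<Prod>v\<in>S. s (odd_repr v)) = 1)
     then int (card (sign_group \<Lambda> (pos_even a))) else 0)"
proof -
  let ?V = "sign_group \<Lambda> (pos_even a)"
  have pm: "s v \<in> {1, - 1}" if "s \<in> ?V" for s v
    using that by (simp add: sign_group_def)
  have sgn_s: "sgn (s v) = s v" if "s \<in> ?V" for s v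
    using pm[OF that, of v] by auto
  have "sign_weight \<Lambda> S a = (\<Sum>s\<in>?V. \<Prod>v\<in>S. sgn (s (odd_repr v) * a v))"
    unfolding sign_weight_def
    by (rule sum.reindex_bij_betw[symmetric, OF signed_abs_bij[OF assms(1,3,4)],
          where g = "\<lambda>f. \<Prod>v\<in>S. sgn (f v)"])
  also have "\<dots> = (\<Sum>s\<in>?V. \<Prod>v\<in>S. s (odd_repr v) * sgn (a v))"
    by (intro sum.cong prod.cong refl) (simp add: sgn_mult sgn_s)
  also have "\<dots> = (\<Sum>s\<in>?V. \<Prod>v\<in>S. s (odd_repr v)) * (\<Prod>v\<in>S. sgn (a v))"
    by (simp add: prod.distrib sum_distrib_right)
  also have "(\<Prod>v\<in>S. sgn (a v)) = (if \<forall>v\<in>S. 0 < a v then 1 else 0)"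
  proof (cases "\<forall>v\<in>S. 0 < a v")
    case False
    then obtain v where "v \<in> S" "a v = 0" using assms(4) by (metis order_less_le)
    then have "(\<Prod>v\<in>S. sgn (a v)) = 0"
      by (intro prod_zero[OF assms(2)] bexI[of _ v]) auto
    then show ?thesis using False by simp
  qed auto
  also have "(\<Sum>s\<in>?V. \<Prod>v\<in>S. s (odd_repr v))
      = (if \<forall>s\<in>?V. (\<Prod>v\<in>S. s (odd_repr v)) = 1 then int (card ?V) else 0)"
  proof (rule sum_character)
    fix s assume s: "s \<in> ?V"
    show "(\<Prod>v\<in>S. s (odd_repr v)) \<in> {1, - 1}"
      using assms(2)
    proof (induction S rule: finite_induct)
      case (insert x S)
      then show ?case using pm[OF s, of "odd_repr x"] by auto
    qed simp
  qed (auto simp: sign_group_sq prod.distrib dest: sign_group_mult[of _ \<Lambda> "pos_even a" _ "pos_even a"])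
  finally show ?thesis by auto
qed

lemma sign_weight_nonneg:
  assumes "even_domain \<Lambda>" "finite S" "a \<in> zero_homs \<Lambda>" "\<And>v. 0 \<le> a v"
  shows "0 \<le> sign_weight \<Lambda> S a"
  by (simp add: sign_weight_eq[OF assms])

text \<open>A non-zero twisted weight equals the group order. Replacing a by \<open>sup a b\<close>
  enlarges the set of non-zero even vertices and so shrinks the sign group; a character that was
  trivial stays trivial, and the inequality for group orders remains.\<close>

lemma sign_weight_supermodular:
  assumes "even_domain \<Lambda>" "finite S"
    and a: "a \<in> zero_homs \<Lambda>" "\<And>v. 0 \<le> a v" and b: "b \<in> zero_homs \<Lambda>" "\<And>v. 0 \<le> b v"
  shows "sign_weight \<Lambda> S a * sign_weight \<Lambda> {} b
    \<le> sign_weight \<Lambda> S (sup a b) * sign_weight \<Lambda> {} (inf a b)"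
proof -
  have sup: "sup a b \<in> zero_homs \<Lambda>" "\<And>v. 0 \<le> sup a b v"
    and inf: "inf a b \<in> zero_homs \<Lambda>" "\<And>v. 0 \<le> inf a b v"
    using sup_inf_in_zero_homs[OF a(1) b(1)] a(2) b(2) by (auto simp: le_supI1)
  show ?thesis
  proof (cases "(\<forall>v\<in>S. 0 < a v) \<and> (\<forall>s\<in>sign_group \<Lambda> (pos_even a). (\<Prod>v\<in>S. s (odd_repr v)) = 1)")
    case False
    then have "sign_weight \<Lambda> S a = 0"
      unfolding sign_weight_eq[OF assms(1,2) a] by (rule if_not_P)
    then show ?thesis
      using sign_weight_nonneg[OF assms(1,2) sup] sign_weight_nonneg[OF assms(1) finite.emptyI inf]
      by (simp del: sup_apply inf_apply)
  next
    case True
    have p: "pos_even (sup a b) = pos_even a \<union> pos_even b"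
      "pos_even (inf a b) = pos_even a \<inter> pos_even b"
      by (auto simp: pos_even_def sup_int_def inf_int_def)
    have "\<forall>v\<in>S. 0 < sup a b v" using True by (auto simp: sup_int_def)
    moreover have "\<forall>s\<in>sign_group \<Lambda> (pos_even (sup a b)). (\<Prod>v\<in>S. s (odd_repr v)) = 1"
      using True by (auto simp: p sign_group_Un)
    ultimately have "sign_weight \<Lambda> S (sup a b) = int (card (sign_group \<Lambda> (pos_even (sup a b))))"
      unfolding sign_weight_eq[OF assms(1,2) sup] by simp
    moreover have "sign_weight \<Lambda> S a = int (card (sign_group \<Lambda> (pos_even a)))"
      unfolding sign_weight_eq[OF assms(1,2) a] using True by simp
    moreover have "sign_weight \<Lambda> {} b = int (card (sign_group \<Lambda> (pos_even b)))"
      "sign_weight \<Lambda> {} (inf a b) = int (card (sign_group \<Lambda> (pos_even (inf a b))))"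
      unfolding sign_weight_eq[OF assms(1) finite.emptyI b] sign_weight_eq[OF assms(1) finite.emptyI inf]
      by simp_all
    moreover have "card (sign_group \<Lambda> (pos_even a)) * card (sign_group \<Lambda> (pos_even b))
        \<le> card (sign_group \<Lambda> (pos_even (sup a b))) * card (sign_group \<Lambda> (pos_even (inf a b)))"
      using card_sign_group_supermodular[of \<Lambda> "pos_even a" "pos_even b"] assms(1)
      by (simp add: p even_domain_def mult.commute)
    ultimately show ?thesis by (simp only: of_nat_le_iff flip: of_nat_mult)
  qed
qed

section \<open>Monotonicity in the domain\<close>

definition sgn_prod :: "'a set \<Rightarrow> ('a \<Rightarrow> int) \<Rightarrow> real" where
  "sgn_prod S f = real_of_int (\<Prod>v\<in>S. sgn (f v))"

definition nonneg_homs :: "(int ^ 'd) set \<Rightarrow> (int ^ 'd \<Rightarrow> int) set" where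
  "nonneg_homs \<Lambda> = {a \<in> zero_homs \<Lambda>. \<forall>v. 0 \<le> a v}"

lemma sum_zero_homs_by_abs:
  assumes "finite \<Lambda>"
  shows "(\<Sum>f\<in>zero_homs \<Lambda>. \<phi> (\<lambda>v. \<bar>f v\<bar>) * sgn_prod S f)
    = (\<Sum>a\<in>nonneg_homs \<Lambda>. \<phi> a * real_of_int (sign_weight \<Lambda> S a))"
proof -
  have "(\<Sum>f\<in>zero_homs \<Lambda>. \<phi> (\<lambda>v. \<bar>f v\<bar>) * sgn_prod S f)
      = (\<Sum>a\<in>nonneg_homs \<Lambda>. \<Sum>f | f \<in> zero_homs \<Lambda> \<and> (\<lambda>v. \<bar>f v\<bar>) = a. \<phi> (\<lambda>v. \<bar>f v\<bar>) * sgn_prod S f)"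
    using assms abs_in_zero_homs
    by (intro sum.group[symmetric]) (auto simp: nonneg_homs_def finite_zero_homs)
  also have "\<dots> = (\<Sum>a\<in>nonneg_homs \<Lambda>. \<phi> a * real_of_int (sign_weight \<Lambda> S a))"
    by (intro sum.cong refl) (simp add: sign_weight_def sgn_prod_def sum_distrib_left)
  finally show ?thesis .
qed

text \<open>The four functions theorem, with \<psi> \<rho> and \<psi> multiplied by the twisted
  weight and 1 and \<rho> by the untwisted one. On the right \<psi> is evaluated at
  \<open>sup a b\<close> and \<rho> at \<open>inf a b\<close>, and both moves increase the value.
  The twist occurs once on each side, as in \<open>sign_weight_supermodular\<close>.\<close>

lemma correlation_inequality:
  fixes \<psi> \<rho> :: "(int ^ 'd \<Rightarrow> int) \<Rightarrow> real"
  assumes \<Lambda>: "even_domain \<Lambda>" and S: "finite S"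
    and \<psi>: "\<And>a b. (\<And>v. 0 \<le> a v) \<Longrightarrow> a \<le> b \<Longrightarrow> 0 \<le> \<psi> a \<and> \<psi> a \<le> \<psi> b"
    and \<rho>: "\<And>a b. (\<And>v. 0 \<le> a v) \<Longrightarrow> a \<le> b \<Longrightarrow> 0 \<le> \<rho> b \<and> \<rho> b \<le> \<rho> a"
  shows "(\<Sum>f\<in>zero_homs \<Lambda>. \<psi> (\<lambda>v. \<bar>f v\<bar>) * \<rho> (\<lambda>v. \<bar>f v\<bar>) * sgn_prod S f) * card (zero_homs \<Lambda>)
    \<le> (\<Sum>f\<in>zero_homs \<Lambda>. \<psi> (\<lambda>v. \<bar>f v\<bar>) * sgn_prod S f) * (\<Sum>f\<in>zero_homs \<Lambda>. \<rho> (\<lambda>v. \<bar>f v\<bar>))"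
proof -
  have fin: "finite \<Lambda>" using \<Lambda> by (simp add: even_domain_def)
  let ?W = "\<lambda>S a. real_of_int (sign_weight \<Lambda> S a)"
  let ?H = "nonneg_homs \<Lambda>"
  have "(\<Sum>a\<in>?H. \<psi> a * \<rho> a * ?W S a) * (\<Sum>a\<in>?H. ?W {} a)
      \<le> (\<Sum>a\<in>?H. \<psi> a * ?W S a) * (\<Sum>a\<in>?H. \<rho> a * ?W {} a)"
  proof (rule four_functions[of ?H \<Lambda>])
    show "finite ?H" using fin by (simp add: nonneg_homs_def finite_zero_homs)
    show "finite \<Lambda>" by fact
    show "a v = b v" if "a \<in> ?H" "b \<in> ?H" "v \<notin> \<Lambda>" for a b v
      using that by (simp add: nonneg_homs_def zero_homs_def)
    show "0 \<le> a v" if "a \<in> ?H" for a v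
      using that by (simp add: nonneg_homs_def)
    show closed: "sup a b \<in> ?H \<and> inf a b \<in> ?H" if "a \<in> ?H" "b \<in> ?H" for a b
      using that sup_inf_in_zero_homs[of a \<Lambda> b] by (auto simp: nonneg_homs_def le_supI1)
    have W: "0 \<le> ?W T a" if "a \<in> ?H" "finite T" for a T
      using that sign_weight_nonneg[OF \<Lambda>] by (auto simp: nonneg_homs_def)
    have \<psi>\<rho>: "0 \<le> \<psi> a" "0 \<le> \<rho> a" if "a \<in> ?H" for a
      using that \<psi>[of a a] \<rho>[of a a] by (auto simp: nonneg_homs_def)
    show "0 \<le> \<psi> a * \<rho> a * ?W S a \<and> 0 \<le> ?W {} a \<and> 0 \<le> \<psi> a * ?W S a \<and> 0 \<le> \<rho> a * ?W {} a"
      if "a \<in> ?H" for a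
      using \<psi>\<rho>[OF that] W[OF that S] W[OF that, of "{}"] by simp
    show "\<psi> a * \<rho> a * ?W S a * ?W {} b
        \<le> (\<psi> (sup a b) * ?W S (sup a b)) * (\<rho> (inf a b) * ?W {} (inf a b))"
      if ab: "a \<in> ?H" "b \<in> ?H" for a b
    proof -
      have nn: "\<And>v. 0 \<le> a v" "\<And>v. 0 \<le> b v" using ab by (auto simp: nonneg_homs_def)
      have "\<psi> a * \<rho> a \<le> \<psi> (sup a b) * \<rho> (inf a b)"
        using \<psi>[of a "sup a b"] \<rho>[of "inf a b" a] nn
          \<psi>\<rho>(2)[OF ab(1)] \<psi>\<rho>(1)[of "sup a b"] closed[OF ab]
        by (intro mult_mono) auto
      moreover have "sign_weight \<Lambda> S a * sign_weight \<Lambda> {} b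
          \<le> sign_weight \<Lambda> S (sup a b) * sign_weight \<Lambda> {} (inf a b)"
        using ab nn by (intro sign_weight_supermodular[OF \<Lambda> S]) (auto simp: nonneg_homs_def)
      then have "?W S a * ?W {} b \<le> ?W S (sup a b) * ?W {} (inf a b)"
        by (metis of_int_le_iff of_int_mult)
      ultimately have "(\<psi> a * \<rho> a) * (?W S a * ?W {} b)
          \<le> (\<psi> (sup a b) * \<rho> (inf a b)) * (?W S (sup a b) * ?W {} (inf a b))"
        using \<psi>\<rho> W S ab closed[OF ab] by (intro mult_mono[of "\<psi> a * \<rho> a"]) auto
      then show ?thesis by (simp add: mult_ac)
    qed
  qed
  moreover have "(\<Sum>a\<in>?H. ?W {} a) = card (zero_homs \<Lambda>)"
    using sum_zero_homs_by_abs[OF fin, of "\<lambda>_. 1" "{}"] by (simp add: sgn_prod_def)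
  moreover have "(\<Sum>a\<in>?H. \<rho> a * ?W {} a) = (\<Sum>f\<in>zero_homs \<Lambda>. \<rho> (\<lambda>v. \<bar>f v\<bar>))"
    using sum_zero_homs_by_abs[OF fin, of \<rho> "{}"] by (simp add: sgn_prod_def)
  ultimately show ?thesis
    using sum_zero_homs_by_abs[OF fin, of "\<lambda>a. \<psi> a * \<rho> a" S] sum_zero_homs_by_abs[OF fin, of \<psi> S]
    by simp
qed

text \<open>The larger model conditioned to vanish on the even vertices of \<open>\<Lambda>' - \<Lambda>\<close> is the smaller
  one together with free signs at the odd vertices of \<open>\<Lambda>' - \<Lambda>\<close>.\<close>

lemma sum_zero_homs_conditioned:
  fixes F :: "(int ^ 'd \<Rightarrow> int) \<Rightarrow> real"
  assumes \<Lambda>: "even_domain \<Lambda>" and \<Lambda>': "even_domain \<Lambda>'" and sub: "\<Lambda> \<subseteq> \<Lambda>'"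
    and F: "\<And>f g. (\<And>v. \<bar>f v\<bar> = \<bar>g v\<bar>) \<Longrightarrow> (\<And>v. v \<in> \<Lambda> \<Longrightarrow> f v = g v) \<Longrightarrow> F f = F g"
  shows "(\<Sum>f | f \<in> zero_homs \<Lambda>' \<and> (\<forall>v\<in>\<Lambda>' - \<Lambda>. even (norm1 v) \<longrightarrow> f v = 0). F f)
    = card ({v \<in> \<Lambda>' - \<Lambda>. odd (norm1 v)} \<rightarrow>\<^sub>E {1, - 1 :: int}) * (\<Sum>f\<in>zero_homs \<Lambda>. F f)"
proof -
  define O' where "O' = {v \<in> \<Lambda>' - \<Lambda>. odd (norm1 v)}"
  define P where "P = O' \<rightarrow>\<^sub>E {1, - 1 :: int}"
  define B where "B = {f \<in> zero_homs \<Lambda>'. \<forall>v\<in>\<Lambda>' - \<Lambda>. even (norm1 v) \<longrightarrow> f v = 0}"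
  define ext where "ext = (\<lambda>(g, s) v. if v \<in> O' then s v else g v :: int)"
  define res where "res = (\<lambda>f :: int ^ 'd \<Rightarrow> int. (\<lambda>v. if v \<in> \<Lambda> then f v else norm1 v mod 2, restrict f O'))"
  \<comment> \<open>Neighbours of an odd vertex are even, and an even vertex of \<Lambda> has all
    its neighbours in \<Lambda>; so no edge joins \<Lambda> to \<open>O'\<close>.\<close>
  have out: "v \<notin> \<Lambda>" if "adjacent u v" "odd (norm1 u)" "u \<notin> \<Lambda>" for u v
    using \<Lambda> that adjacent_parity[OF that(1)] adjacent_commute[of u v]
    by (auto simp: even_domain_def)
  \<comment> \<open>An arbitrarily chosen even neighbour already vanishes, either by the
    conditioning or by lying outside the larger domain; parity then leaves only 1 and -1.\<close>
  have abs_O': "\<bar>f v\<bar> = 1" if f: "f \<in> B" and v: "v \<in> O'" for f v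
  proof -
    let ?w = "v + axis undefined 1"
    have w: "adjacent v ?w" by (rule adjacent_axis)
    then have "?w \<notin> \<Lambda>" "even (norm1 ?w)"
      using out[OF w] v adjacent_parity[OF w] by (auto simp: O'_def)
    then have "f ?w = 0" using f by (cases "?w \<in> \<Lambda>'") (auto simp: B_def zero_homs_def)
    moreover have "\<bar>f v - f ?w\<bar> \<le> 1" "odd (f v)"
      using f v w by (auto simp: B_def zero_homs_def hom_height_UNIV_iff O'_def)
    ultimately have "- 1 \<le> f v" "f v \<le> 1" "odd (f v)" by auto
    then have "f v = 1 \<or> f v = - 1" by presburger
    then show ?thesis by auto
  qed
  have "(\<Sum>f\<in>B. F f) = (\<Sum>x\<in>zero_homs \<Lambda> \<times> P. F (fst x))"
  proof (rule sum.reindex_bij_witness[of _ ext res])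
    fix f assume f: "f \<in> B"
    have out_zero: "f v = 0" if "v \<notin> \<Lambda>" "even (norm1 v)" for v
      using f that by (cases "v \<in> \<Lambda>'") (auto simp: B_def zero_homs_def)
    show "ext (res f) = f"
    proof
      fix v
      show "ext (res f) v = f v"
        using f out_zero[of v]
        by (cases "even (norm1 v)"; cases "v \<in> \<Lambda>'")
          (auto simp: ext_def res_def O'_def B_def zero_homs_def)
    qed
    have "fst (res f) \<in> hom_height UNIV"
    proof (rule hom_height_UNIV_I)
      fix u v :: "int ^ 'd" assume uv: "adjacent u v" "even (norm1 v)"
      have "\<bar>f u - f v\<bar> \<le> 1"
        using f uv by (auto simp: B_def zero_homs_def hom_height_UNIV_iff)
      moreover have "v \<notin> \<Lambda>" "norm1 u mod 2 = 1" if "u \<notin> \<Lambda>"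
        using out[OF uv(1)] uv that adjacent_parity[OF uv(1)]
        by (auto simp: odd_iff_mod_2_eq_one)
      ultimately show "\<bar>fst (res f) u - fst (res f) v\<bar> \<le> 1"
        using out_zero[of v] uv by (auto simp: res_def)
    next
      show "even (fst (res f) v) \<longleftrightarrow> even (norm1 v)" for v
        using f by (auto simp: res_def B_def zero_homs_def hom_height_UNIV_iff)
    qed
    moreover have "restrict f O' \<in> P"
      using abs_O'[OF f] by (force simp: P_def abs_eq_iff')
    ultimately show "res f \<in> zero_homs \<Lambda> \<times> P"
      by (auto simp: res_def zero_homs_def)
    show "F (fst (res f)) = F f"
    proof (rule F)
      show "\<bar>fst (res f) v\<bar> = \<bar>f v\<bar>" for v
        using abs_O'[OF f, of v] out_zero[of v] f
        by (cases "even (norm1 v)"; cases "v \<in> \<Lambda>'")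
          (auto simp: res_def O'_def B_def zero_homs_def odd_iff_mod_2_eq_one)
    qed (simp add: res_def)
  next
    fix x assume x: "x \<in> zero_homs \<Lambda> \<times> P"
    then obtain g s where x_eq: "x = (g, s)" and g: "g \<in> zero_homs \<Lambda>" and s: "s \<in> P" by auto
    have off: "g v = norm1 v mod 2" if "v \<notin> \<Lambda>" for v
      using g that by (simp add: zero_homs_def)
    have s1: "s v = 1 \<or> s v = - 1" if "v \<in> O'" for v
      using s that by (auto simp: P_def)
    show "res (ext x) = x"
      using s off by (auto simp: x_eq res_def ext_def O'_def P_def fun_eq_iff PiE_iff extensional_def)
    have "ext (g, s) \<in> hom_height UNIV"
    proof (rule hom_height_UNIV_I)
      fix u v :: "int ^ 'd" assume uv: "adjacent u v" "even (norm1 v)"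
      have guv: "\<bar>g u - g v\<bar> \<le> 1"
        using g uv by (auto simp: zero_homs_def hom_height_UNIV_iff)
      have v: "v \<notin> O'" using uv by (simp add: O'_def)
      show "\<bar>ext (g, s) u - ext (g, s) v\<bar> \<le> 1"
      proof (cases "u \<in> O'")
        case True
        then have "g v = 0"
          using out[OF uv(1)] off[of v] uv(2) by (auto simp: O'_def)
        then show ?thesis using s1[OF True] v True by (auto simp: ext_def)
      qed (use guv v in \<open>simp add: ext_def\<close>)
    next
      fix v
      show "even (ext (g, s) v) \<longleftrightarrow> even (norm1 v)"
        using s1[of v] g by (auto simp: ext_def O'_def zero_homs_def hom_height_UNIV_iff)
    qed
    moreover have "ext (g, s) v = norm1 v mod 2" if "v \<notin> \<Lambda>'" for v
      using that off[of v] sub by (auto simp: ext_def O'_def)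
    moreover have "ext (g, s) v = 0" if "v \<in> \<Lambda>' - \<Lambda>" "even (norm1 v)" for v
      using that off[of v] by (auto simp: ext_def O'_def)
    ultimately show "ext x \<in> B" by (auto simp: x_eq B_def zero_homs_def)
  qed
  also have "\<dots> = card P * (\<Sum>f\<in>zero_homs \<Lambda>. F f)"
    using sum.cartesian_product[of "\<lambda>g s. F g" P "zero_homs \<Lambda>"]
    by (simp add: sum_distrib_left case_prod_beta)
  finally show ?thesis by (simp add: B_def P_def O'_def)
qed

definition zero_mean :: "(int ^ 'd) set \<Rightarrow> ((int ^ 'd \<Rightarrow> int) \<Rightarrow> real) \<Rightarrow> real" where
  "zero_mean \<Lambda> F = (\<Sum>f\<in>zero_homs \<Lambda>. F f) / card (zero_homs \<Lambda>)"

lemma zero_mean_mono_domain: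
  fixes \<psi> :: "(int ^ 'd \<Rightarrow> int) \<Rightarrow> real"
  assumes \<Lambda>: "even_domain \<Lambda>" and \<Lambda>': "even_domain \<Lambda>'" and sub: "S \<subseteq> \<Lambda>" "\<Lambda> \<subseteq> \<Lambda>'"
    and \<psi>: "\<And>a b. (\<And>v. 0 \<le> a v) \<Longrightarrow> a \<le> b \<Longrightarrow> 0 \<le> \<psi> a \<and> \<psi> a \<le> \<psi> b"
  shows "zero_mean \<Lambda> (\<lambda>f. \<psi> (\<lambda>v. \<bar>f v\<bar>) * sgn_prod S f)
    \<le> zero_mean \<Lambda>' (\<lambda>f. \<psi> (\<lambda>v. \<bar>f v\<bar>) * sgn_prod S f)"
proof -
  let ?F = "\<lambda>f. \<psi> (\<lambda>v. \<bar>f v\<bar>) * sgn_prod S f"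
  let ?Z = "\<lambda>f. \<forall>v\<in>\<Lambda>' - \<Lambda>. even (norm1 v) \<longrightarrow> f v = (0 :: int)"
  \<comment> \<open>If a non-negative function vanishes somewhere, so does every smaller
    non-negative one; hence this indicator is decreasing on absolute values.\<close>
  define \<rho> :: "(int ^ 'd \<Rightarrow> int) \<Rightarrow> real" where "\<rho> f = of_bool (?Z f)" for f
  define c where "c = card ({v \<in> \<Lambda>' - \<Lambda>. odd (norm1 v)} \<rightarrow>\<^sub>E {1, - 1 :: int})"
  have fin: "finite \<Lambda>" "finite \<Lambda>'" using \<Lambda> \<Lambda>' by (auto simp: even_domain_def)
  have card_pos: "0 < card (zero_homs \<Lambda>)" "0 < card (zero_homs \<Lambda>')"
    using fin zero_homs_nonempty by (auto simp: card_gt_0_iff finite_zero_homs)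
  have c: "c > 0"
    unfolding c_def card_gt_0_iff using fin by (auto intro!: finite_PiE simp: PiE_eq_empty_iff)
  have \<rho>: "0 \<le> \<rho> b \<and> \<rho> b \<le> \<rho> a" if "\<And>v. 0 \<le> a v" "a \<le> b" for a b
  proof -
    have "a v = 0" if "b v = 0" for v
      using \<open>a \<le> b\<close> \<open>0 \<le> a v\<close> that by (metis le_fun_def order_antisym)
    then show ?thesis by (auto simp: \<rho>_def)
  qed
  have if_sum: "(\<Sum>f\<in>zero_homs \<Lambda>'. G f * \<rho> (\<lambda>v. \<bar>f v\<bar>)) = (\<Sum>f | f \<in> zero_homs \<Lambda>' \<and> ?Z f. G f)"
    for G :: "(int ^ 'd \<Rightarrow> int) \<Rightarrow> real"
    using fin by (intro sum.mono_neutral_cong_right) (auto simp: finite_zero_homs \<rho>_def)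
  have "(\<Sum>f\<in>zero_homs \<Lambda>'. ?F f * \<rho> (\<lambda>v. \<bar>f v\<bar>)) = c * (\<Sum>f\<in>zero_homs \<Lambda>. ?F f)"
    unfolding if_sum c_def
    by (rule sum_zero_homs_conditioned[OF \<Lambda> \<Lambda>' sub(2)])
      (use sub(1) in \<open>auto simp: sgn_prod_def intro!: arg_cong2[where f = "(*)"] prod.cong\<close>)
  \<comment> \<open>The constant function measures the conditioning event itself. The number
    \<open>c\<close> of free sign patterns enters both identities and cancels in the conditional
    mean.\<close>
  moreover have "(\<Sum>f\<in>zero_homs \<Lambda>'. 1 * \<rho> (\<lambda>v. \<bar>f v\<bar>)) = c * (\<Sum>f\<in>zero_homs \<Lambda>. 1 :: real)"
    unfolding if_sum c_def by (intro sum_zero_homs_conditioned \<Lambda> \<Lambda>' sub refl)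
  moreover have "(\<Sum>f\<in>zero_homs \<Lambda>'. \<psi> (\<lambda>v. \<bar>f v\<bar>) * \<rho> (\<lambda>v. \<bar>f v\<bar>) * sgn_prod S f) * card (zero_homs \<Lambda>')
      \<le> (\<Sum>f\<in>zero_homs \<Lambda>'. ?F f) * (\<Sum>f\<in>zero_homs \<Lambda>'. \<rho> (\<lambda>v. \<bar>f v\<bar>))"
    by (rule correlation_inequality[OF \<Lambda>' finite_subset[OF sub(1) fin(1)] \<psi> \<rho>])
  ultimately have "c * ((\<Sum>f\<in>zero_homs \<Lambda>. ?F f) * card (zero_homs \<Lambda>'))
      \<le> c * ((\<Sum>f\<in>zero_homs \<Lambda>'. ?F f) * card (zero_homs \<Lambda>))"
    by (simp add: mult_ac)
  then show ?thesis
    using c card_pos by (simp add: zero_mean_def field_simps)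
qed

lemma zero_mean_add: "zero_mean \<Lambda> (\<lambda>f. F f + G f) = zero_mean \<Lambda> F + zero_mean \<Lambda> G"
  by (simp add: zero_mean_def sum.distrib add_divide_distrib)

lemma zero_mean_diff: "zero_mean \<Lambda> (\<lambda>f. F f - G f) = zero_mean \<Lambda> F - zero_mean \<Lambda> G"
  by (simp add: zero_mean_def sum_subtractf diff_divide_distrib)

lemma zero_mean_cmult: "zero_mean \<Lambda> (\<lambda>f. c * F f) = c * zero_mean \<Lambda> F"
  by (simp add: zero_mean_def sum_distrib_left)

lemma zero_mean_eq_integral:
  assumes "finite \<Lambda>"
  shows "zero_mean \<Lambda> F = measure_pmf.expectation (pmf_of_set (zero_homs \<Lambda>)) F"
  using assms by (simp add: zero_mean_def integral_pmf_of_set zero_homs_nonempty finite_zero_homs)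

section \<open>Convergence along the directed set of even domains\<close>

text \<open>The net of even domains ordered by inclusion, written as a filter so that the usual
  limit rules apply. The odd balls are cofinal in it, which keeps it proper.\<close>

definition even_domains :: "(int ^ 'd) set filter" where
  "even_domains = (INF K\<in>{K. finite K}. principal {\<Lambda>. even_domain \<Lambda> \<and> K \<subseteq> \<Lambda>})"

lemma eventually_even_domains:
  "eventually P even_domains \<longleftrightarrow> (\<exists>K. finite K \<and> (\<forall>\<Lambda>. even_domain \<Lambda> \<longrightarrow> K \<subseteq> \<Lambda> \<longrightarrow> P \<Lambda>))"
proof -
  have "eventually P even_domains \<longleftrightarrow>
      (\<exists>K\<in>{K. finite K}. eventually P (principal {\<Lambda>. even_domain \<Lambda> \<and> K \<subseteq> \<Lambda>}))"
    unfolding even_domains_def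
  proof (rule eventually_INF_base)
    show "\<exists>x\<in>{K. finite K}. principal {\<Lambda>. even_domain \<Lambda> \<and> x \<subseteq> \<Lambda>}
        \<le> inf (principal {\<Lambda>. even_domain \<Lambda> \<and> a \<subseteq> \<Lambda>}) (principal {\<Lambda>. even_domain \<Lambda> \<and> b \<subseteq> \<Lambda>})"
      if "a \<in> {K. finite K}" "b \<in> {K. finite K}" for a b :: "(int ^ 'a) set"
      using that by (intro bexI[of _ "a \<union> b"]) auto
  qed auto
  then show ?thesis by (auto simp: eventually_principal)
qed

lemma filterlim_even_domains:
  assumes "eventually (\<lambda>x. even_domain (X x)) F" "\<And>K. finite K \<Longrightarrow> eventually (\<lambda>x. K \<subseteq> X x) F"
  shows "filterlim X even_domains F"
  unfolding even_domains_def filterlim_INF filterlim_principal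
  using assms by (auto intro: eventually_conj)

lemma even_domain_ball1:
  assumes "odd L"
  shows "even_domain (ball1 L)"
  unfolding even_domain_def
proof (intro conjI ballI allI impI finite_ball1)
  fix u v :: "int ^ 'a" assume u: "u \<in> ball1 L" and uv: "adjacent u v" "even (norm1 u)"
  \<comment> \<open>An even vertex in a ball of odd radius has norm at most L - 1, which leaves room
    for one step.\<close>
  have "norm1 u \<noteq> int L" using uv(2) assms by auto
  then have "norm1 u < int L" using u by (simp add: ball1_def)
  moreover have "norm1 v \<le> norm1 u + 1"
    using norm1_add_le[of u "v - u"] uv(1) by (simp add: adjacent_def norm1_minus_commute)
  ultimately show "v \<in> ball1 L" by (simp add: ball1_def)
qed

lemma filterlim_ball1: "filterlim (\<lambda>n. ball1 (2 * n + 1)) even_domains sequentially"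
proof (rule filterlim_even_domains)
  fix K :: "(int ^ 'a) set" assume "finite K"
  then obtain N where N: "\<And>n. N \<le> n \<Longrightarrow> K \<subseteq> ball1 n" by (rule finite_subset_ball1) blast
  show "\<forall>\<^sub>F n in sequentially. K \<subseteq> ball1 (2 * n + 1)"
    using eventually_ge_at_top[of N] by eventually_elim (rule N, simp)
qed (simp add: even_domain_ball1)

text \<open>A bounded monotone net converges to its supremum, here over the even domains that
  contain S, where monotonicity in the domain is available.\<close>

lemma zero_mean_mono_convergent:
  fixes \<psi> :: "(int ^ 'd \<Rightarrow> int) \<Rightarrow> real"
  assumes S: "finite S"
    and \<psi>: "\<And>a b. (\<And>v. 0 \<le> a v) \<Longrightarrow> a \<le> b \<Longrightarrow> 0 \<le> \<psi> a \<and> \<psi> a \<le> \<psi> b" "\<And>a. \<psi> a \<le> 1"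
  shows "\<exists>l. ((\<lambda>\<Lambda>. zero_mean \<Lambda> (\<lambda>f. \<psi> (\<lambda>v. \<bar>f v\<bar>) * sgn_prod S f)) \<longlongrightarrow> l) even_domains"
proof -
  let ?m = "\<lambda>\<Lambda>. zero_mean \<Lambda> (\<lambda>f. \<psi> (\<lambda>v. \<bar>f v\<bar>) * sgn_prod S f)"
  define \<D> where "\<D> = {\<Lambda>. even_domain \<Lambda> \<and> S \<subseteq> \<Lambda>}"
  obtain N where N: "\<And>n. N \<le> n \<Longrightarrow> S \<subseteq> ball1 n" using S by (rule finite_subset_ball1) blast
  have "ball1 (2 * N + 1) \<in> \<D>" using N[of "2 * N + 1"] by (simp add: \<D>_def even_domain_ball1)
  then have ne: "\<D> \<noteq> {}" by blast
  have "?m \<Lambda> \<le> 1" for \<Lambda>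
  proof -
    have "\<psi> (\<lambda>v. \<bar>f v\<bar>) * sgn_prod S f \<le> 1" for f
    proof -
      have "\<bar>sgn_prod S f\<bar> \<le> 1"
        unfolding sgn_prod_def of_int_prod abs_prod by (intro prod_le_1) (auto simp: sgn_if)
      moreover have "0 \<le> \<psi> (\<lambda>v. \<bar>f v\<bar>)" "\<psi> (\<lambda>v. \<bar>f v\<bar>) \<le> 1" using \<psi>[of "\<lambda>v. \<bar>f v\<bar>"] by auto
      ultimately have "\<bar>\<psi> (\<lambda>v. \<bar>f v\<bar>) * sgn_prod S f\<bar> \<le> 1"
        unfolding abs_mult by (intro mult_le_one) auto
      then show ?thesis by simp
    qed
    then have "(\<Sum>f\<in>zero_homs \<Lambda>. \<psi> (\<lambda>v. \<bar>f v\<bar>) * sgn_prod S f) \<le> card (zero_homs \<Lambda>)"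
      using sum_bounded_above[of "zero_homs \<Lambda>" "\<lambda>f. \<psi> (\<lambda>v. \<bar>f v\<bar>) * sgn_prod S f" 1] by simp
    then show ?thesis
      by (cases "card (zero_homs \<Lambda>) = 0") (auto simp: zero_mean_def divide_le_eq_1)
  qed
  then have bdd: "bdd_above (?m ` \<D>)" by (intro bdd_aboveI[of _ 1]) auto
  have "(?m \<longlongrightarrow> (SUP \<Lambda>\<in>\<D>. ?m \<Lambda>)) even_domains"
  proof (rule order_tendstoI)
    fix y assume "y < (SUP \<Lambda>\<in>\<D>. ?m \<Lambda>)"
    then obtain \<Lambda>\<^sub>0 where \<Lambda>\<^sub>0: "\<Lambda>\<^sub>0 \<in> \<D>" "y < ?m \<Lambda>\<^sub>0" using less_cSUP_iff[OF ne bdd] by auto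
    show "\<forall>\<^sub>F \<Lambda> in even_domains. y < ?m \<Lambda>"
      unfolding eventually_even_domains
    proof (intro exI conjI allI impI)
      show "finite \<Lambda>\<^sub>0" using \<Lambda>\<^sub>0 by (simp add: \<D>_def even_domain_def)
      fix \<Lambda> assume "even_domain \<Lambda>" "\<Lambda>\<^sub>0 \<subseteq> \<Lambda>"
      then have "?m \<Lambda>\<^sub>0 \<le> ?m \<Lambda>"
        using \<Lambda>\<^sub>0 \<psi>(1) by (intro zero_mean_mono_domain) (auto simp: \<D>_def)
      then show "y < ?m \<Lambda>" using \<Lambda>\<^sub>0(2) by simp
    qed
  next
    fix y assume y: "(SUP \<Lambda>\<in>\<D>. ?m \<Lambda>) < y"
    show "\<forall>\<^sub>F \<Lambda> in even_domains. ?m \<Lambda> < y"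
      unfolding eventually_even_domains
    proof (intro exI conjI allI impI)
      fix \<Lambda> :: "(int ^ 'd) set" assume "even_domain \<Lambda>" "S \<subseteq> \<Lambda>"
      then have "?m \<Lambda> \<le> (SUP \<Lambda>\<in>\<D>. ?m \<Lambda>)" by (intro cSUP_upper bdd) (simp add: \<D>_def)
      then show "?m \<Lambda> < y" using y by simp
    qed fact
  qed
  then show ?thesis by blast
qed

text \<open>The indicator of \<open>f v = x\<close> is a linear combination of products of a power of \<open>sgn (f v)\<close> with
  an increasing function of \<open>\<bar>f v\<bar>\<close>, for which the preceding lemma applies.\<close>

lemma zero_mean_indicator_convergent_aux:
  fixes \<psi> :: "(int ^ 'd \<Rightarrow> int) \<Rightarrow> real" and b :: "int ^ 'd \<Rightarrow> int"
  assumes "finite D" "finite S" "S \<inter> D = {}"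
    and "\<And>a b. (\<And>v. 0 \<le> a v) \<Longrightarrow> a \<le> b \<Longrightarrow> 0 \<le> \<psi> a \<and> \<psi> a \<le> \<psi> b" "\<And>a. \<psi> a \<le> 1"
  shows "\<exists>l. ((\<lambda>\<Lambda>. zero_mean \<Lambda> (\<lambda>f. \<psi> (\<lambda>v. \<bar>f v\<bar>) * sgn_prod S f * of_bool (\<forall>v\<in>D. f v = b v)))
    \<longlongrightarrow> l) even_domains"
  using assms
proof (induction D arbitrary: S \<psi> rule: finite_induct)
  case empty
  then show ?case using zero_mean_mono_convergent[of S \<psi>] by simp
next
  case (insert x D)
  let ?F = "\<lambda>\<psi> S f. \<psi> (\<lambda>v. \<bar>f v\<bar>) * sgn_prod S f * of_bool (\<forall>v\<in>D. f v = b v)"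
  have conv: "\<exists>l. ((\<lambda>\<Lambda>. zero_mean \<Lambda> (?F (\<lambda>a. \<psi> a * of_bool (k \<le> a x)) S')) \<longlongrightarrow> l) even_domains"
    if "S' \<in> {S, insert x S}" for k S'
  proof (rule insert.IH)
    show "finite S'" "S' \<inter> D = {}" using that insert.hyps insert.prems by auto
    show "0 \<le> \<psi> a * of_bool (k \<le> a x) \<and> \<psi> a * of_bool (k \<le> a x) \<le> \<psi> a' * of_bool (k \<le> a' x)"
      if "\<And>v. 0 \<le> a v" "a \<le> a'" for a a'
      using insert.prems(3)[OF that] le_funD[OF that(2), of x] by auto
    show "\<psi> a * of_bool (k \<le> a x) \<le> 1" for a
      using insert.prems(4)[of a] by simp
  qed
  let ?G = "\<lambda>k S. ?F (\<lambda>a. \<psi> a * of_bool (k \<le> a x)) S"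
  define y where "y = b x"
  \<comment> \<open>The difference of the thresholds |y| and |y| + 1 is the indicator of |f x| =
    |y|. For y \<noteq> 0 the average of 1 and sgn y sgn (f x) selects the sign, whence 1/2; for y =
    0 the second part has coefficient 0 and the factor is 1. As x is not in S, passing to
    \<open>insert x S\<close> contributes exactly one new sign.\<close>
  have "?F \<psi> S f * of_bool (f x = y) = c * (?G \<bar>y\<bar> S f - ?G (\<bar>y\<bar> + 1) S f
      + real_of_int (sgn y) * (?G \<bar>y\<bar> (insert x S) f - ?G (\<bar>y\<bar> + 1) (insert x S) f))"
    if "c = (if y = 0 then 1 else 1 / 2)" for c f
  proof -
    have "sgn_prod (insert x S) f = real_of_int (sgn (f x)) * sgn_prod S f"
      using insert.prems(1,2) by (simp add: sgn_prod_def)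
    then show ?thesis
      using that by (auto simp: sgn_if)
  qed
  then have eq: "zero_mean \<Lambda> (\<lambda>f. ?F \<psi> S f * of_bool (f x = y)) = (if y = 0 then 1 else 1 / 2) *
      (zero_mean \<Lambda> (?G \<bar>y\<bar> S) - zero_mean \<Lambda> (?G (\<bar>y\<bar> + 1) S)
      + real_of_int (sgn y) * (zero_mean \<Lambda> (?G \<bar>y\<bar> (insert x S)) - zero_mean \<Lambda> (?G (\<bar>y\<bar> + 1) (insert x S))))"
    for \<Lambda>
    by (simp only: zero_mean_add zero_mean_diff zero_mean_cmult)
  obtain l1 l2 l3 l4 where
    "((\<lambda>\<Lambda>. zero_mean \<Lambda> (?G \<bar>y\<bar> S)) \<longlongrightarrow> l1) even_domains"
    "((\<lambda>\<Lambda>. zero_mean \<Lambda> (?G (\<bar>y\<bar> + 1) S)) \<longlongrightarrow> l2) even_domains"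
    "((\<lambda>\<Lambda>. zero_mean \<Lambda> (?G \<bar>y\<bar> (insert x S))) \<longlongrightarrow> l3) even_domains"
    "((\<lambda>\<Lambda>. zero_mean \<Lambda> (?G (\<bar>y\<bar> + 1) (insert x S))) \<longlongrightarrow> l4) even_domains"
    using conv[of S "\<bar>y\<bar>"] conv[of S "\<bar>y\<bar> + 1"] conv[of "insert x S" "\<bar>y\<bar>"]
      conv[of "insert x S" "\<bar>y\<bar> + 1"] by blast
  then have "((\<lambda>\<Lambda>. zero_mean \<Lambda> (\<lambda>f. ?F \<psi> S f * of_bool (f x = y))) \<longlongrightarrow>
      (if y = 0 then 1 else 1 / 2) * (l1 - l2 + real_of_int (sgn y) * (l3 - l4))) even_domains"
    unfolding eq by (intro tendsto_intros)
  then show ?case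
    by (auto simp: y_def mult.assoc conj_commute simp flip: of_bool_conj)
qed

lemma zero_mean_indicator_convergent:
  fixes b :: "int ^ 'd \<Rightarrow> int"
  assumes "finite D"
  shows "\<exists>l. ((\<lambda>\<Lambda>. zero_mean \<Lambda> (\<lambda>f. of_bool (\<forall>v\<in>D. f v = b v))) \<longlongrightarrow> l) even_domains"
  using zero_mean_indicator_convergent_aux[OF assms, of "{}" "\<lambda>_. 1" b] by (simp add: sgn_prod_def)

section \<open>Limits of discrete distributions\<close>

text \<open>Finite sums of the pointwise limits are always at most 1, but mass may escape; tightness
  brings these sums arbitrarily close to 1.\<close>

lemma ex_limit_pmf:
  fixes p :: "'i \<Rightarrow> 'b pmf"
  assumes ne: "F \<noteq> bot"
    and conv: "\<And>b. \<exists>l. ((\<lambda>i. pmf (p i) b) \<longlongrightarrow> l) F"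
    and tight: "\<And>\<epsilon>. 0 < \<epsilon> \<Longrightarrow> \<exists>B. finite B \<and> (\<forall>\<^sub>F i in F. 1 - \<epsilon> \<le> measure_pmf.prob (p i) B)"
  obtains q where "\<And>b. ((\<lambda>i. pmf (p i) b) \<longlongrightarrow> pmf q b) F"
proof -
  obtain l where l: "\<And>b. ((\<lambda>i. pmf (p i) b) \<longlongrightarrow> l b) F"
    using conv by metis
  have l_sum: "((\<lambda>i. measure_pmf.prob (p i) B) \<longlongrightarrow> sum l B) F" if "finite B" for B
    using that by (simp add: measure_measure_pmf_finite) (intro tendsto_sum l)
  have l_nonneg: "0 \<le> l b" for b
    by (rule tendsto_lowerbound[OF l _ ne]) simp
  have le_1: "sum l B \<le> 1" if "finite B" for B
    by (rule tendsto_upperbound[OF l_sum[OF that] _ ne]) simp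
  have "(l has_sum 1) UNIV"
    unfolding has_sum_def
  proof (rule order_tendstoI)
    fix y :: real assume "y < 1"
    then obtain B where B: "finite B" "\<forall>\<^sub>F i in F. 1 - (1 - y) / 2 \<le> measure_pmf.prob (p i) B"
      using tight[of "(1 - y) / 2"] by auto
    have "1 - (1 - y) / 2 \<le> sum l B"
      by (rule tendsto_lowerbound[OF l_sum[OF B(1)] B(2) ne])
    then have "y < sum l B" using \<open>y < 1\<close> by (simp add: field_simps)
    moreover have "sum l B \<le> sum l X" if "finite X" "B \<subseteq> X" for X
      using that l_nonneg by (intro sum_mono2) auto
    ultimately show "\<forall>\<^sub>F X in finite_subsets_at_top UNIV. y < sum l X"
      using B(1) unfolding eventually_finite_subsets_at_top by (intro exI[of _ B]) fastforce
  next
    fix y :: real assume "1 < y"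
    then show "\<forall>\<^sub>F X in finite_subsets_at_top UNIV. sum l X < y"
      using le_1 by (intro eventually_finite_subsets_at_top_weakI) fastforce
  qed
  then have sum1: "infsum l UNIV = 1" and "l summable_on UNIV"
    using has_sum_imp_summable infsumI by blast+
  then have abs: "Infinite_Set_Sum.abs_summable_on l UNIV"
    using abs_summable_equivalent[of l UNIV] by (simp add: l_nonneg)
  have "(\<integral>\<^sup>+ b. ennreal (l b) \<partial>count_space UNIV) = 1"
    using nn_integral_conv_infsetsum[OF abs] infsetsum_infsum[OF abs] sum1 l_nonneg by simp
  then have "pmf (embed_pmf l) b = l b" for b
    using l_nonneg by (intro pmf_embed_pmf)
  then show ?thesis using l that[of "embed_pmf l"] by simp
qed

text \<open>The limit has total mass 1, so a finite set B carrying most of q eventually carries most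
  of \<open>p i\<close> too. Outside B a bounded g contributes little, and on B the integral is a
  finite sum.\<close>

lemma pmf_integral_tendsto:
  fixes p :: "'i \<Rightarrow> 'b pmf" and g :: "'b \<Rightarrow> real"
  assumes lim: "\<And>b. ((\<lambda>i. pmf (p i) b) \<longlongrightarrow> pmf q b) F" and g: "bounded (range g)"
  shows "((\<lambda>i. measure_pmf.expectation (p i) g) \<longlongrightarrow> measure_pmf.expectation q g) F"
proof -
  obtain C where C: "C > 0" "\<And>b. \<bar>g b\<bar> \<le> C"
    using g by (auto simp: bounded_pos)
  have int: "integrable (measure_pmf r) (\<lambda>b. h b * g b)"
    if "\<And>b. \<bar>h b\<bar> \<le> (1::real)" for r h
  proof (rule measure_pmf.integrable_const_bound[of _ C])
    have "\<bar>h b * g b\<bar> \<le> C" for b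
      using mult_mono[OF that C(2), of b b] C(1) by (simp add: abs_mult)
    then show "AE b in measure_pmf r. norm (h b * g b) \<le> C" by simp
  qed simp
  have approx: "\<bar>measure_pmf.expectation r g - (\<Sum>b\<in>B. pmf r b * g b)\<bar> \<le> C * (1 - measure_pmf.prob r B)"
    if B: "finite B" for r B
  proof -
    have "measure_pmf.expectation r g =
        measure_pmf.expectation r (\<lambda>b. indicator B b * g b) + measure_pmf.expectation r (\<lambda>b. indicator (- B) b * g b)"
      by (subst Bochner_Integration.integral_add[symmetric])
        (auto intro!: int Bochner_Integration.integral_cong split: split_indicator)
    moreover have "measure_pmf.expectation r (\<lambda>b. indicator B b * g b) = (\<Sum>b\<in>B. pmf r b * g b)"
      using B by (subst integral_measure_pmf[of B]) (auto intro!: sum.cong split: split_indicator_asm)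
    moreover have "\<bar>measure_pmf.expectation r (\<lambda>b. indicator (- B) b * g b)\<bar>
        \<le> measure_pmf.expectation r (\<lambda>b. C * indicator (- B) b)"
      using C
      by (intro order_trans[OF integral_abs_bound] integral_mono integrable_abs int integrable_mult_right
          measure_pmf.integrable_const_bound[of _ 1])
        (auto simp: abs_mult split: split_indicator)
    moreover have "measure_pmf.expectation r (\<lambda>b. C * indicator (- B) b) = C * (1 - measure_pmf.prob r B)"
      using measure_pmf.prob_compl[of B r] by (simp add: Compl_eq_Diff_UNIV)
    ultimately show ?thesis by linarith
  qed
  show ?thesis
  proof (rule tendstoI)
    fix e :: real assume e: "0 < e"
    \<comment> \<open>The two tails contribute at most C * d = e/8 each and the finite sums differ
      by less than e/4, so the total stays below e.\<close>
    define d where "d = e / (8 * C)"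
    have d: "0 < d" "C * d = e / 8" using e C by (auto simp: d_def)
    obtain B where B: "finite B" "1 - d < measure_pmf.prob q B"
    proof -
      have "(pmf q has_sum 1) UNIV"
        using infsetsum_pmf_eq_1[of q UNIV] infsetsum_infsum[OF pmf_abs_summable, of q UNIV]
          abs_summable_equivalent[of "pmf q" UNIV] has_sum_infsum[of "pmf q" UNIV]
        by (simp add: pmf_abs_summable)
      then have "\<forall>\<^sub>F X in finite_subsets_at_top UNIV. 1 - d < sum (pmf q) X"
        unfolding has_sum_def using d by (intro order_tendstoD(1)) auto
      then obtain X where "finite X" "1 - d < sum (pmf q) X"
        unfolding eventually_finite_subsets_at_top by blast
      then show ?thesis using that by (simp add: measure_measure_pmf_finite)
    qed
    have "((\<lambda>i. measure_pmf.prob (p i) B) \<longlongrightarrow> measure_pmf.prob q B) F"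
      using B(1) by (simp add: measure_measure_pmf_finite) (intro tendsto_sum lim)
    then have "\<forall>\<^sub>F i in F. 1 - d < measure_pmf.prob (p i) B"
      using B(2) by (rule order_tendstoD)
    moreover have "((\<lambda>i. \<Sum>b\<in>B. pmf (p i) b * g b) \<longlongrightarrow> (\<Sum>b\<in>B. pmf q b * g b)) F"
      by (intro tendsto_intros lim)
    then have "\<forall>\<^sub>F i in F. dist (\<Sum>b\<in>B. pmf (p i) b * g b) (\<Sum>b\<in>B. pmf q b * g b) < e / 4"
      using e by (intro tendstoD) auto
    ultimately show "\<forall>\<^sub>F i in F. dist (measure_pmf.expectation (p i) g) (measure_pmf.expectation q g) < e"
    proof eventually_elim
      case (elim i)
      have "C * (1 - measure_pmf.prob (p i) B) \<le> e / 8" "C * (1 - measure_pmf.prob q B) \<le> e / 8"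
        using elim B C d(2) mult_left_mono[of "1 - measure_pmf.prob (p i) B" d C]
          mult_left_mono[of "1 - measure_pmf.prob q B" d C] by auto
      then show ?case
        using approx[OF B(1), of "p i"] approx[OF B(1), of q] elim(2) e
        unfolding dist_real_def by linarith
    qed
  qed
qed

section \<open>Cylinder events and the Kolmogorov extension for countable state spaces\<close>

lemma sets_PiM_borel_discrete:
  "finite J \<Longrightarrow> sets (PiM J (\<lambda>_. borel :: 'a::countable discrete measure)) = Pow (PiE J (\<lambda>_. UNIV))"
  using count_space_PiM_finite[of J "\<lambda>_. UNIV :: 'a discrete set"]
    sets_PiM_cong[of J J "\<lambda>_. borel" "\<lambda>_. count_space (UNIV :: 'a discrete set)"]
  by (simp add: sets_borel_eq_count_space)

lemma cylinder_in_sets: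
  fixes X :: "('i \<Rightarrow> 'a::countable) set"
  assumes "finite J" "J \<subseteq> D"
  shows "{f \<in> space (PiM D (\<lambda>_. count_space UNIV)). restrict f J \<in> X} \<in> sets (PiM D (\<lambda>_. count_space UNIV))"
proof -
  let ?M = "\<lambda>D. PiM D (\<lambda>_. count_space (UNIV :: 'a set))"
  have "(\<lambda>f. restrict f J) -` (X \<inter> PiE J (\<lambda>_. UNIV)) \<inter> space (?M D) \<in> sets (?M D)"
    using assms by (intro measurable_sets[OF measurable_restrict_subset]) (auto simp: count_space_PiM_finite)
  also have "(\<lambda>f. restrict f J) -` (X \<inter> PiE J (\<lambda>_. UNIV)) \<inter> space (?M D)
      = {f \<in> space (?M D). restrict f J \<in> X}"
    by auto
  finally show ?thesis .
qed

text \<open>The Kolmogorov extension theorem needs a Polish state space, whence the detour through the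
  discrete topology.\<close>

lemma ex_projective_limit_pmf:
  fixes q :: "'i set \<Rightarrow> ('i \<Rightarrow> 'a::countable) pmf"
  assumes q: "\<And>J H. J \<subseteq> H \<Longrightarrow> finite H \<Longrightarrow> q J = map_pmf (\<lambda>f. restrict f J) (q H)"
  obtains \<mu> where "prob_space \<mu>" "sets \<mu> = sets (PiM UNIV (\<lambda>_. count_space UNIV))"
    "\<And>J X. finite J \<Longrightarrow> measure \<mu> {f. restrict f J \<in> X} = measure_pmf.prob (q J) X"
proof -
  let ?B = "\<lambda>_ :: 'i. borel :: 'a discrete measure"
  define emb where "emb J f = restrict (\<lambda>i. discrete (f i)) J" for J :: "'i set" and f :: "'i \<Rightarrow> 'a"
  define P where "P J = distr (measure_pmf (q J)) (PiM J ?B) (emb J)" for J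
  have emb_meas: "emb J \<in> measurable (measure_pmf r) (PiM J ?B)" for J r
    by (auto simp: emb_def space_PiM)
  have "projective_family UNIV P ?B"
  proof (rule projective_family.intro)
    fix J H :: "'i set" assume JH: "J \<subseteq> H" "finite H"
    have "distr (P H) (PiM J ?B) (\<lambda>f. restrict f J)
        = distr (measure_pmf (q H)) (PiM J ?B) ((\<lambda>f. restrict f J) \<circ> emb H)"
      unfolding P_def using JH by (intro distr_distr measurable_restrict_subset emb_meas)
    also have "(\<lambda>f. restrict f J) \<circ> emb H = emb J \<circ> (\<lambda>f. restrict f J)"
      using JH by (auto simp: emb_def fun_eq_iff restrict_def)
    also have "distr (measure_pmf (q H)) (PiM J ?B) \<dots> = distr (measure_pmf (q J)) (PiM J ?B) (emb J)"
      unfolding q[OF JH] map_pmf_rep_eq by (intro distr_distr[symmetric]) (auto simp: emb_def space_PiM)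
    finally show "P J = distr (P H) (PiM J ?B) (\<lambda>f. restrict f J)" unfolding P_def by (rule sym)
  next
    show "prob_space (P J)" for J
      unfolding P_def by (intro measure_pmf.prob_space_distr emb_meas)
  qed
  then interpret polish_projective UNIV P
    by (rule polish_projective.intro)
  define un where "un = (\<lambda>(f :: 'i \<Rightarrow> 'a discrete) i. of_discrete (f i))"
  define \<mu> where "\<mu> = distr lim (PiM UNIV (\<lambda>_. count_space UNIV)) un"
  have un: "un \<in> measurable lim (PiM UNIV (\<lambda>_. count_space UNIV))"
    unfolding un_def
  proof (rule measurable_PiM_single')
    fix i :: 'i
    have "of_discrete \<in> measurable (borel :: 'a discrete measure) (count_space UNIV)"
      by (subst measurable_cong_sets[OF sets_borel_eq_count_space refl]) simp
    then show "(\<lambda>f. of_discrete (f i)) \<in> measurable lim (count_space UNIV)"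
      using measurable_compose[OF measurable_component_singleton[OF UNIV_I, of i ?B]]
      by (subst measurable_cong_sets[OF sets_lim refl])
  qed auto
  show ?thesis
  proof (rule that)
    show "prob_space \<mu>" unfolding \<mu>_def by (rule P.prob_space_distr[OF un])
    show "sets \<mu> = sets (PiM UNIV (\<lambda>_. count_space UNIV))" by (simp add: \<mu>_def)
    fix J :: "'i set" and X assume J: "finite J"
    define Y where "Y = {g \<in> PiE J (\<lambda>_. UNIV). restrict (un g) J \<in> X}"
    have Y: "Y \<in> sets (PiM J ?B)" using J by (auto simp: sets_PiM_borel_discrete Y_def)
    have "{f. restrict f J \<in> X} \<in> sets (PiM UNIV (\<lambda>_. count_space (UNIV :: 'a set)))"
      using cylinder_in_sets[OF J subset_UNIV, of X] by (simp add: space_PiM)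
    then have "measure \<mu> {f. restrict f J \<in> X} = measure lim (un -` {f. restrict f J \<in> X} \<inter> space lim)"
      unfolding \<mu>_def by (rule measure_distr[OF un])
    also have "un -` {f. restrict f J \<in> X} \<inter> space lim = prod_emb UNIV ?B J Y"
      by (auto simp: prod_emb_def Y_def un_def space_PiM restrict_def cong: if_cong)
    also have "measure lim (prod_emb UNIV ?B J Y) = measure (P J) Y"
      by (rule measure_lim_emb[OF _ J Y]) simp
    also have "\<dots> = measure_pmf.prob (q J) (emb J -` Y)"
      unfolding P_def by (subst measure_distr[OF emb_meas Y]) simp
    also have "emb J -` Y = (\<lambda>f. restrict f J) -` X"
      by (auto simp: emb_def Y_def un_def discrete_inverse restrict_def cong: if_cong)
    also have "measure_pmf.prob (q J) ((\<lambda>f. restrict f J) -` X) = measure_pmf.prob (q J) X"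
      by (subst (2) q[OF subset_refl J]) simp
    finally show "measure \<mu> {f. restrict f J \<in> X} = measure_pmf.prob (q J) X" .
  qed
qed

section \<open>Finite-volume measures\<close>

lemma finite_outer_boundary:
  assumes "finite \<Lambda>"
  shows "finite (outer_boundary \<Lambda>)"
proof (rule finite_subset)
  show "outer_boundary \<Lambda> \<subseteq> (\<Union>u\<in>\<Lambda>. (\<lambda>x. u - x) ` ball1 1)"
  proof
    fix v assume "v \<in> outer_boundary \<Lambda>"
    then obtain u where u: "u \<in> \<Lambda>" "norm1 (u - v) = 1"
      by (auto simp: outer_boundary_def adjacent_def)
    then have "v = u - (u - v)" "u - v \<in> ball1 1" by (auto simp: ball1_def)
    then show "v \<in> (\<Union>u\<in>\<Lambda>. (\<lambda>x. u - x) ` ball1 1)" using u by blast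
  qed
  show "finite (\<Union>u\<in>\<Lambda>. (\<lambda>x. u - x) ` ball1 1)"
    using assms by (simp add: finite_ball1)
qed

lemma finite_plus_closure: "finite \<Lambda> \<Longrightarrow> finite (plus_closure \<Lambda>)"
  by (simp add: plus_closure_def finite_outer_boundary)

definition bc_homs :: "(int ^ 'd) set \<Rightarrow> (int ^ 'd \<Rightarrow> int) \<Rightarrow> (int ^ 'd \<Rightarrow> int) set" where
  "bc_homs \<Lambda> \<tau> = {c \<in> hom_height (plus_closure \<Lambda>). \<forall>v\<in>outer_boundary \<Lambda>. c v = \<tau> v}"

definition glue :: "(int ^ 'd) set \<Rightarrow> (int ^ 'd \<Rightarrow> int) \<Rightarrow> (int ^ 'd \<Rightarrow> int) \<Rightarrow> int ^ 'd \<Rightarrow> int" where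
  "glue \<Lambda> f c v = (if v \<in> \<Lambda> then c v else f v)"

lemma finite_volume_eq: "finite_volume \<Lambda> \<tau> = pmf_of_set (bc_homs \<Lambda> \<tau>)"
  by (simp add: finite_volume_def bc_homs_def)

lemma bc_homs_cong: "(\<And>v. v \<notin> \<Lambda> \<Longrightarrow> \<tau> v = \<tau>' v) \<Longrightarrow> bc_homs \<Lambda> \<tau> = bc_homs \<Lambda> \<tau>'"
  by (auto simp: bc_homs_def outer_boundary_def)

lemma restrict_in_bc_homs:
  "f \<in> hom_height UNIV \<Longrightarrow> restrict f (plus_closure \<Lambda>) \<in> bc_homs \<Lambda> f"
  by (auto simp: bc_homs_def hom_height_def plus_closure_def)

lemma restrict_glue:
  assumes "c \<in> bc_homs \<Lambda> f"
  shows "restrict (glue \<Lambda> f c) (plus_closure \<Lambda>) = c"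
  using assms by (auto simp: bc_homs_def hom_height_def extensional_def glue_def plus_closure_def
      outer_boundary_def fun_eq_iff)

lemma glue_restrict: "\<Lambda> \<subseteq> D \<Longrightarrow> glue \<Lambda> (glue \<Lambda> f c) (restrict f D) = f"
  by (auto simp: glue_def fun_eq_iff)

text \<open>An edge meeting \<Lambda> lies in \<open>plus_closure \<Lambda>\<close>, where the glued
  function is c because c and f agree on the boundary; any other edge sees only f.\<close>

lemma glue_in_zero_homs:
  assumes f: "f \<in> zero_homs \<Lambda>'" and c: "c \<in> bc_homs \<Lambda> f" and sub: "\<Lambda> \<subseteq> \<Lambda>'"
  shows "glue \<Lambda> f c \<in> zero_homs \<Lambda>'"
proof -
  have cf: "glue \<Lambda> f c v = c v" if "v \<in> plus_closure \<Lambda>" for v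
    using fun_cong[OF restrict_glue[OF c], of v] that by simp
  have "glue \<Lambda> f c \<in> hom_height UNIV"
  proof (rule hom_height_UNIV_I)
    fix u v :: "int ^ 'a" assume uv: "adjacent u v"
    show "\<bar>glue \<Lambda> f c u - glue \<Lambda> f c v\<bar> \<le> 1"
    proof (cases "u \<in> \<Lambda> \<or> v \<in> \<Lambda>")
      case True
      then have p: "u \<in> plus_closure \<Lambda>" "v \<in> plus_closure \<Lambda>"
        using uv adjacent_commute[of u v] by (auto simp: plus_closure_def outer_boundary_def)
      then have "\<bar>c u - c v\<bar> \<le> norm1 (u - v)"
        using c by (simp add: bc_homs_def hom_height_def)
      then show ?thesis using p uv by (simp add: cf adjacent_def)
    next
      case False
      then show ?thesis using f uv by (simp add: glue_def zero_homs_def hom_height_UNIV_iff)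
    qed
  next
    fix v
    show "even (glue \<Lambda> f c v) \<longleftrightarrow> even (norm1 v)"
    proof (cases "v \<in> \<Lambda>")
      case True
      then have "c v mod 2 = norm1 v mod 2"
        using c by (auto simp: bc_homs_def hom_height_def plus_closure_def)
      then show ?thesis using True by (simp add: glue_def even_iff_mod_2_eq_zero)
    next
      case False
      then show ?thesis using f by (simp add: glue_def zero_homs_def hom_height_UNIV_iff)
    qed
  qed
  then show ?thesis
    using f sub by (auto simp: zero_homs_def glue_def)
qed

lemma finite_bc_homs:
  assumes f: "f \<in> zero_homs \<Lambda>'" and "\<Lambda> \<subseteq> \<Lambda>'" "finite \<Lambda>'"
  shows "finite (bc_homs \<Lambda> f)"
proof (rule inj_on_finite)
  show "inj_on (glue \<Lambda> f) (bc_homs \<Lambda> f)"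
    by (rule inj_on_inverseI[where g = "\<lambda>f. restrict f (plus_closure \<Lambda>)"]) (rule restrict_glue)
  show "glue \<Lambda> f ` bc_homs \<Lambda> f \<subseteq> zero_homs \<Lambda>'"
    using assms by (auto intro: glue_in_zero_homs)
  show "finite (zero_homs \<Lambda>')" using assms by (simp add: finite_zero_homs)
qed

text \<open>The outer boundary of an even domain is even, and the flat extension is 0 there. So
  restriction to the closure is a bijection onto the configurations with zero boundary values and
  carries one uniform law to the other.\<close>

lemma finite_volume_zero:
  assumes \<Lambda>: "even_domain \<Lambda>"
  shows "finite_volume \<Lambda> (\<lambda>_. 0) = map_pmf (\<lambda>f. restrict f (plus_closure \<Lambda>)) (pmf_of_set (zero_homs \<Lambda>))"
proof -
  have even_bd: "norm1 v mod 2 = 0" if "v \<in> outer_boundary \<Lambda>" for v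
  proof -
    have "even (norm1 v)"
      using that \<Lambda> adjacent_parity by (auto simp: outer_boundary_def even_domain_def)
    then show ?thesis by (simp add: even_iff_mod_2_eq_zero)
  qed
  have fin: "finite \<Lambda>" using \<Lambda> by (simp add: even_domain_def)
  have zero: "f v = 0" if "f \<in> zero_homs \<Lambda>" "v \<in> outer_boundary \<Lambda>" for f v
    using that even_bd by (auto simp: zero_homs_def outer_boundary_def)
  have "inj_on (\<lambda>f. restrict f (plus_closure \<Lambda>)) (zero_homs \<Lambda>)"
  proof (rule inj_onI, rule ext)
    fix f g v
    assume fg: "f \<in> zero_homs \<Lambda>" "g \<in> zero_homs \<Lambda>"
      and eq: "restrict f (plus_closure \<Lambda>) = restrict g (plus_closure \<Lambda>)"
    show "f v = g v"
      using fg fun_cong[OF eq, of v] by (cases "v \<in> \<Lambda>") (auto simp: zero_homs_def plus_closure_def)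
  qed
  moreover have "(\<lambda>f. restrict f (plus_closure \<Lambda>)) ` zero_homs \<Lambda> = bc_homs \<Lambda> (\<lambda>_. 0)"
  proof (intro equalityI image_subsetI subsetI)
    fix f assume f: "f \<in> zero_homs \<Lambda>"
    then have "restrict f (plus_closure \<Lambda>) \<in> bc_homs \<Lambda> f"
      by (intro restrict_in_bc_homs) (simp add: zero_homs_def)
    then show "restrict f (plus_closure \<Lambda>) \<in> bc_homs \<Lambda> (\<lambda>_. 0)"
      using zero[OF f] by (simp add: bc_homs_def)
  next
    fix c assume "c \<in> bc_homs \<Lambda> (\<lambda>_. 0)"
    then have "c \<in> bc_homs \<Lambda> (\<lambda>v. norm1 v mod 2)"
      by (simp add: bc_homs_def even_bd)
    then have "glue \<Lambda> (\<lambda>v. norm1 v mod 2) c \<in> zero_homs \<Lambda>"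
      "c = restrict (glue \<Lambda> (\<lambda>v. norm1 v mod 2) c) (plus_closure \<Lambda>)"
      using glue_in_zero_homs[OF flat_in_zero_homs] restrict_glue by (blast, metis)
    then show "c \<in> (\<lambda>f. restrict f (plus_closure \<Lambda>)) ` zero_homs \<Lambda>" by blast
  qed
  ultimately show ?thesis
    using fin by (simp add: finite_volume_eq map_pmf_of_set_inj zero_homs_nonempty finite_zero_homs)
qed

text \<open>The finite-volume DLR equation: resampling \<open>f\<close> inside \<open>\<Lambda>\<close> is the involution
  exchanging the values of \<open>f\<close> on \<open>\<Lambda>\<close> with those of the new sample \<open>c\<close>.\<close>

lemma zero_mean_resample:
  fixes G :: "(int ^ 'd \<Rightarrow> int) \<Rightarrow> real"
  assumes sub: "\<Lambda> \<subseteq> \<Lambda>'" and fin: "finite \<Lambda>'"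
    and G: "\<And>f g. (\<And>v. v \<notin> \<Lambda> \<Longrightarrow> f v = g v) \<Longrightarrow> G f = G g"
  shows "zero_mean \<Lambda>' (\<lambda>f. measure_pmf.prob (finite_volume \<Lambda> (restrict f (outer_boundary \<Lambda>))) A * G f)
    = zero_mean \<Lambda>' (\<lambda>f. indicator A (restrict f (plus_closure \<Lambda>)) * G f)"
proof -
  let ?r = "\<lambda>f. restrict f (plus_closure \<Lambda>)"
  let ?n = "\<lambda>f. real (card (bc_homs \<Lambda> f))"
  have hom: "f \<in> hom_height UNIV" if "f \<in> zero_homs \<Lambda>'" for f
    using that by (simp add: zero_homs_def)
  have finV: "finite (bc_homs \<Lambda> f)" if "f \<in> zero_homs \<Lambda>'" for f
    using that sub fin by (rule finite_bc_homs)
  have neV: "bc_homs \<Lambda> f \<noteq> {}" if "f \<in> zero_homs \<Lambda>'" for f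
    using restrict_in_bc_homs[OF hom[OF that]] by blast
  have bd: "bc_homs \<Lambda> (restrict f (outer_boundary \<Lambda>)) = bc_homs \<Lambda> f" for f
    by (auto simp: bc_homs_def)
  have glue_off: "bc_homs \<Lambda> (glue \<Lambda> f c) = bc_homs \<Lambda> f" "G (glue \<Lambda> f c) = G f" for f c
    by (rule bc_homs_cong, simp add: glue_def) (rule G, simp add: glue_def)
  have prob: "measure_pmf.prob (finite_volume \<Lambda> (restrict f (outer_boundary \<Lambda>))) A
      = (\<Sum>c\<in>bc_homs \<Lambda> f. indicator A c) / ?n f" if "f \<in> zero_homs \<Lambda>'" for f
  proof -
    have "(\<Sum>c\<in>bc_homs \<Lambda> f. indicator A c :: real) = (\<Sum>c\<in>bc_homs \<Lambda> f \<inter> A. 1)"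
      using finV[OF that] by (intro sum.mono_neutral_cong_right) auto
    then show ?thesis
      using finV[OF that] neV[OF that] by (simp add: finite_volume_eq bd measure_pmf_of_set)
  qed
  have "(\<Sum>f\<in>zero_homs \<Lambda>'. measure_pmf.prob (finite_volume \<Lambda> (restrict f (outer_boundary \<Lambda>))) A * G f)
      = (\<Sum>f\<in>zero_homs \<Lambda>'. \<Sum>c\<in>bc_homs \<Lambda> f. indicator A c * G f / ?n f)"
    by (intro sum.cong refl) (simp add: prob sum_distrib_right sum_divide_distrib)
  also have "\<dots> = (\<Sum>(f, c)\<in>(SIGMA f:zero_homs \<Lambda>'. bc_homs \<Lambda> f). indicator A c * G f / ?n f)"
    using fin finV by (intro sum.Sigma) (auto simp: finite_zero_homs)
  also have "\<dots> = (\<Sum>(f, c)\<in>(SIGMA f:zero_homs \<Lambda>'. bc_homs \<Lambda> f). indicator A (?r f) * G f / ?n f)"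
  \<comment> \<open>The exchange leaves f unchanged off \<Lambda>, hence also \<open>G f\<close>,
    the set of admissible fillings and the weight 1 / \<open>?n f\<close>; only the argument of the
    indicator moves from c to f.\<close>
  proof (rule sum.reindex_bij_witness[of _ "\<lambda>(f, c). (glue \<Lambda> f c, ?r f)" "\<lambda>(f, c). (glue \<Lambda> f c, ?r f)"])
    have "\<Lambda> \<subseteq> plus_closure \<Lambda>" by (simp add: plus_closure_def)
    note simps = restrict_glue glue_restrict[OF this] glue_off restrict_in_bc_homs[OF hom]
      glue_in_zero_homs[OF _ _ sub]
    fix x assume "x \<in> (SIGMA f:zero_homs \<Lambda>'. bc_homs \<Lambda> f)"
    then obtain f c where x: "x = (f, c)" "f \<in> zero_homs \<Lambda>'" "c \<in> bc_homs \<Lambda> f" by auto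
    show "(case case x of (f, c) \<Rightarrow> (glue \<Lambda> f c, ?r f) of (f, c) \<Rightarrow> (glue \<Lambda> f c, ?r f)) = x"
      "(case case x of (f, c) \<Rightarrow> (glue \<Lambda> f c, ?r f) of (f, c) \<Rightarrow> (glue \<Lambda> f c, ?r f)) = x"
      "(case x of (f, c) \<Rightarrow> (glue \<Lambda> f c, ?r f)) \<in> (SIGMA f:zero_homs \<Lambda>'. bc_homs \<Lambda> f)"
      "(case x of (f, c) \<Rightarrow> (glue \<Lambda> f c, ?r f)) \<in> (SIGMA f:zero_homs \<Lambda>'. bc_homs \<Lambda> f)"
      "(case case x of (f, c) \<Rightarrow> (glue \<Lambda> f c, ?r f) of (f, c) \<Rightarrow> indicator A (?r f) * G f / ?n f)
        = (case x of (f, c) \<Rightarrow> indicator A c * G f / ?n f)"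
      using x by (simp_all add: simps)
  qed
  also have "\<dots> = (\<Sum>f\<in>zero_homs \<Lambda>'. \<Sum>c\<in>bc_homs \<Lambda> f. indicator A (?r f) * G f / ?n f)"
    using fin finV by (intro sum.Sigma[symmetric]) (auto simp: finite_zero_homs)
  also have "\<dots> = (\<Sum>f\<in>zero_homs \<Lambda>'. indicator A (?r f) * G f)"
    using finV neV by (intro sum.cong refl) simp
  finally show ?thesis by (simp add: zero_mean_def)
qed

section \<open>Translations by even vectors\<close>

lemma even_lattice_parity: "w \<in> even_lattice \<Longrightarrow> norm1 (v + w) mod 2 = norm1 v mod 2"
  using even_norm1_add[of v w] by (auto simp: even_lattice_def odd_iff_mod_2_eq_one even_iff_mod_2_eq_zero)

lemma shift_in_hom_height:
  assumes "w \<in> even_lattice" "f \<in> hom_height UNIV"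
  shows "(\<lambda>v. f (v + w)) \<in> hom_height UNIV"
proof -
  have "\<bar>f (u + w) - f (v + w)\<bar> \<le> norm1 (u - v)" for u v
  proof -
    have "\<bar>f (u + w) - f (v + w)\<bar> \<le> norm1 ((u + w) - (v + w))"
      using assms(2) unfolding hom_height_def by blast
    then show ?thesis by simp
  qed
  then show ?thesis using assms by (simp add: hom_height_def even_lattice_parity)
qed

text \<open>An even translation preserves parity and hence the flat values outside the domain, so it
  maps the configurations of \<Lambda> bijectively onto those of the shifted domain.\<close>

lemma zero_mean_shift:
  assumes w: "w \<in> even_lattice"
  shows "zero_mean \<Lambda> (\<lambda>f. F (\<lambda>v. f (v + w))) = zero_mean ((\<lambda>v. v - w) ` \<Lambda>) F"
proof -
  have w': "- w \<in> even_lattice" using w by (simp add: even_lattice_def)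
  have mem: "v \<in> (\<lambda>v. v - w) ` \<Lambda> \<longleftrightarrow> v + w \<in> \<Lambda>" for v
    by (auto intro: rev_image_eqI)
  have "bij_betw (\<lambda>f v. f (v + w)) (zero_homs \<Lambda>) (zero_homs ((\<lambda>v. v - w) ` \<Lambda>))"
  proof (rule bij_betw_byWitness[where f' = "\<lambda>f v. f (v - w)"])
    show "(\<lambda>f v. f (v + w)) ` zero_homs \<Lambda> \<subseteq> zero_homs ((\<lambda>v. v - w) ` \<Lambda>)"
      using w by (auto simp: zero_homs_def shift_in_hom_height mem even_lattice_parity)
    have "(\<lambda>v. f (v + - w)) \<in> zero_homs \<Lambda>" if f: "f \<in> zero_homs ((\<lambda>v. v - w) ` \<Lambda>)" for f
    proof -
      have "f (v + - w) = norm1 v mod 2" if "v \<notin> \<Lambda>" for v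
        using f that mem[of "v + - w"] even_lattice_parity[OF w', of v] by (simp add: zero_homs_def)
      then show ?thesis
        using f shift_in_hom_height[OF w'] by (simp add: zero_homs_def)
    qed
    then show "(\<lambda>f v. f (v - w)) ` zero_homs ((\<lambda>v. v - w) ` \<Lambda>) \<subseteq> zero_homs \<Lambda>" by auto
  qed auto
  then show ?thesis
    using sum.reindex_bij_betw[of _ _ _ F] bij_betw_same_card unfolding zero_mean_def by metis
qed

lemma filterlim_shift_even_domains:
  assumes w: "w \<in> even_lattice"
  shows "filterlim (\<lambda>\<Lambda>. (\<lambda>v. v - w) ` \<Lambda>) even_domains even_domains"
proof (rule filterlim_even_domains)
  have "even_domain ((\<lambda>v. v - w) ` \<Lambda>)" if \<Lambda>: "even_domain \<Lambda>" for \<Lambda>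
    unfolding even_domain_def
  proof (intro conjI ballI allI impI)
    fix u v assume "u \<in> (\<lambda>v. v - w) ` \<Lambda>" and uv: "adjacent u v" "even (norm1 u)"
    then have "u + w \<in> \<Lambda>" by auto
    moreover have "adjacent (u + w) (v + w)" using uv by (simp add: adjacent_def)
    moreover have "even (norm1 (u + w))"
      using uv even_lattice_parity[OF w, of u] by (simp add: even_iff_mod_2_eq_zero)
    ultimately have "v + w \<in> \<Lambda>" using \<Lambda> by (auto simp: even_domain_def)
    then show "v \<in> (\<lambda>v. v - w) ` \<Lambda>" by (rule rev_image_eqI) simp
  qed (use \<Lambda> in \<open>simp add: even_domain_def\<close>)
  then show "\<forall>\<^sub>F \<Lambda> in even_domains. even_domain ((\<lambda>v. v - w) ` \<Lambda>)"
    unfolding eventually_even_domains by blast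
  fix K :: "(int ^ 'a) set" assume K: "finite K"
  show "\<forall>\<^sub>F \<Lambda> in even_domains. K \<subseteq> (\<lambda>v. v - w) ` \<Lambda>"
    unfolding eventually_even_domains
  proof (intro exI[of _ "(\<lambda>v. v + w) ` K"] conjI allI impI subsetI)
    fix \<Lambda> v assume "(\<lambda>v. v + w) ` K \<subseteq> \<Lambda>" "v \<in> K"
    then have "v + w \<in> \<Lambda>" by blast
    then show "v \<in> (\<lambda>v. v - w) ` \<Lambda>" by (rule rev_image_eqI) simp
  qed (use K in simp)
qed

section \<open>Limits of the marginals on finite sets\<close>

lemma even_domains_neq_bot: "(even_domains :: (int ^ 'd) set filter) \<noteq> bot"
  using filterlim_ball1 by (metis filterlim_def filtermap_bot_iff le_bot trivial_limit_sequentially)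

text \<open>Probabilities of single configurations on D are known to converge, so the point is that
  no mass escapes. The Lipschitz condition reduces this to the height at the origin, and
  monotonicity in the domain carries the bound from the odd balls to every even domain.\<close>

lemma ex_limit_marginal:
  fixes D :: "(int ^ 'd) set"
  assumes tight: "\<And>\<epsilon>. 0 < \<epsilon> \<Longrightarrow>
      \<exists>M. \<forall>n. zero_mean (ball1 (2 * n + 1) :: (int ^ 'd) set) (\<lambda>f. of_bool (M < \<bar>f 0\<bar>)) \<le> \<epsilon>"
    and D: "finite D"
  obtains q where "\<And>g :: (int ^ 'd \<Rightarrow> int) \<Rightarrow> real. bounded (range g) \<Longrightarrow>
    ((\<lambda>\<Lambda>. zero_mean \<Lambda> (\<lambda>f. g (restrict f D))) \<longlongrightarrow> measure_pmf.expectation q g) even_domains"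
proof -
  let ?r = "\<lambda>f. restrict f D"
  define p where "p \<Lambda> = map_pmf ?r (pmf_of_set (zero_homs \<Lambda>))" for \<Lambda> :: "(int ^ 'd) set"
  have p: "\<forall>\<^sub>F \<Lambda> in even_domains. zero_mean \<Lambda> (\<lambda>f. g (?r f)) = measure_pmf.expectation (p \<Lambda>) g" for g
    unfolding eventually_even_domains p_def
    by (intro exI[of _ "{}"]) (auto simp: even_domain_def zero_mean_eq_integral)
  have conv: "\<exists>l. ((\<lambda>\<Lambda>. pmf (p \<Lambda>) b) \<longlongrightarrow> l) even_domains" for b
  proof -
    have "\<exists>l. ((\<lambda>\<Lambda>. zero_mean \<Lambda> (\<lambda>f. indicator {b} (?r f))) \<longlongrightarrow> l) even_domains"
    proof (cases "b \<in> extensional D")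
      case True
      then have "indicator {b} (?r f) = (of_bool (\<forall>v\<in>D. f v = b v) :: real)" for f
        by (auto simp: fun_eq_iff extensional_def indicator_def)
      then show ?thesis using zero_mean_indicator_convergent[OF D, of b] by simp
    next
      case False
      then have "indicator {b} (?r f) = (0 :: real)" for f
        by (metis indicator_simps(2) restrict_extensional singletonD)
      then show ?thesis by (auto simp: zero_mean_def)
    qed
    then show ?thesis
      using p[of "indicator {b}"] by (auto simp: measure_pmf_single dest: Lim_transform_eventually)
  qed
  have "\<exists>B. finite B \<and> (\<forall>\<^sub>F \<Lambda> in even_domains. 1 - \<epsilon> \<le> measure_pmf.prob (p \<Lambda>) B)" if \<epsilon>: "0 < \<epsilon>" for \<epsilon>
  proof -
    obtain M where M: "\<And>n. zero_mean (ball1 (2 * n + 1) :: (int ^ 'd) set) (\<lambda>f. of_bool (M < \<bar>f 0\<bar>)) \<le> \<epsilon>"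
      using tight[OF \<epsilon>] by blast
    \<comment> \<open>Heights at v are within \<open>norm1 v\<close> of the height at the origin, so
      |f 0| \<le> M confines the restriction of f to this finite box.\<close>
    define B where "B = PiE D (\<lambda>v. {- (M + norm1 v)..M + norm1 v})"
    have "1 - \<epsilon> \<le> zero_mean \<Lambda> (\<lambda>f. indicator B (?r f))" if \<Lambda>: "even_domain \<Lambda>" for \<Lambda>
    proof -
      have fin: "finite \<Lambda>" using \<Lambda> by (simp add: even_domain_def)
      \<comment> \<open>Every even domain sits inside an odd ball, where the event M < |f 0|, being
        increasing in |f|, is at least as likely.\<close>
      then obtain N where "\<And>n. N \<le> n \<Longrightarrow> \<Lambda> \<subseteq> ball1 n" by (rule finite_subset_ball1) blast
      then have sub: "\<Lambda> \<subseteq> ball1 (2 * N + 1)" by simp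
      have "zero_mean \<Lambda> (\<lambda>f. of_bool (M < \<bar>f 0\<bar>) * sgn_prod {} f)
          \<le> zero_mean (ball1 (2 * N + 1)) (\<lambda>f :: int ^ 'd \<Rightarrow> int. of_bool (M < \<bar>f 0\<bar>) * sgn_prod {} f)"
        by (rule zero_mean_mono_domain[OF \<Lambda> even_domain_ball1 _ sub, where \<psi> = "\<lambda>a. of_bool (M < a 0)"])
          (auto simp: le_fun_def intro: less_le_trans)
      also have "\<dots> \<le> \<epsilon>" using M[of N] by (simp add: sgn_prod_def)
      finally have "1 - \<epsilon> \<le> 1 - zero_mean \<Lambda> (\<lambda>f. of_bool (M < \<bar>f 0\<bar>))"
        by (simp add: sgn_prod_def)
      also have "\<dots> = zero_mean \<Lambda> (\<lambda>f. 1 - of_bool (M < \<bar>f 0\<bar>))"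
        unfolding zero_mean_diff using zero_homs_nonempty finite_zero_homs[OF fin]
        by (simp add: zero_mean_def)
      also have "\<dots> \<le> zero_mean \<Lambda> (\<lambda>f. indicator B (?r f))"
        unfolding zero_mean_def
      proof (intro divide_right_mono sum_mono)
        fix f assume f: "f \<in> zero_homs \<Lambda>"
        have "?r f \<in> B" if "\<bar>f 0\<bar> \<le> M"
        proof -
          have "\<bar>f v - f 0\<bar> \<le> norm1 (v - 0)" for v
            using f unfolding zero_homs_def hom_height_def by blast
          then have "f v \<in> {- (M + norm1 v)..M + norm1 v}" for v
            using that by (smt (verit) atLeastAtMost_iff diff_zero)
          then show ?thesis by (auto simp: B_def)
        qed
        then show "1 - of_bool (M < \<bar>f 0\<bar>) \<le> (indicator B (?r f) :: real)"
          by (cases "M < \<bar>f 0\<bar>") auto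
      qed simp
      finally show ?thesis .
    qed
    then have "\<forall>\<^sub>F \<Lambda> in even_domains. 1 - \<epsilon> \<le> zero_mean \<Lambda> (\<lambda>f. indicator B (?r f))"
      unfolding eventually_even_domains by blast
    with p[of "indicator B"] have "\<forall>\<^sub>F \<Lambda> in even_domains. 1 - \<epsilon> \<le> measure_pmf.prob (p \<Lambda>) B"
      by eventually_elim simp
    moreover have "finite B" using D by (auto simp: B_def intro: finite_PiE)
    ultimately show ?thesis by blast
  qed
  from ex_limit_pmf[OF even_domains_neq_bot conv this] obtain q
    where "\<And>b. ((\<lambda>\<Lambda>. pmf (p \<Lambda>) b) \<longlongrightarrow> pmf q b) even_domains" by blast
  from pmf_integral_tendsto[OF this] have
    "((\<lambda>\<Lambda>. measure_pmf.expectation (p \<Lambda>) g) \<longlongrightarrow> measure_pmf.expectation q g) even_domains"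
    if "bounded (range g)" for g :: "(int ^ 'd \<Rightarrow> int) \<Rightarrow> real"
    using that by blast
  then have "((\<lambda>\<Lambda>. zero_mean \<Lambda> (\<lambda>f. g (?r f))) \<longlongrightarrow> measure_pmf.expectation q g) even_domains"
    if "bounded (range g)" for g :: "(int ^ 'd \<Rightarrow> int) \<Rightarrow> real"
  proof (rule Lim_transform_eventually)
    show "\<forall>\<^sub>F \<Lambda> in even_domains. measure_pmf.expectation (p \<Lambda>) g = zero_mean \<Lambda> (\<lambda>f. g (?r f))"
      using p[of g] by eventually_elim simp
  qed (use that in blast)
  then show ?thesis by (rule that)
qed

section \<open>The limiting Gibbs measure\<close>

text \<open>Provides a generator that is closed under intersection. The set X of values is
  arbitrary, which is sound because a finite J carries only countably many configurations.\<close>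

lemma sets_sigma_restrict:
  "sets (sigma_restrict \<mu> D) =
    sigma_sets (space \<mu>) {{f \<in> space \<mu>. restrict f J \<in> X} |J X. finite J \<and> J \<subseteq> D}"
proof -
  let ?G = "{{f \<in> space \<mu>. restrict f J \<in> X} |J X. finite J \<and> J \<subseteq> D}"
  let ?G1 = "{{f \<in> (\<Pi>\<^sub>E i\<in>D. space (count_space (UNIV :: int set))). f i \<in> A} |i A. i \<in> D \<and> A \<in> sets (count_space (UNIV :: int set))}"
  let ?P = "\<Pi>\<^sub>E i\<in>D. space (count_space (UNIV :: int set))"
  have r: "(\<lambda>f. restrict f D) \<in> space \<mu> \<rightarrow> ?P" by auto
  have eq: "{(\<lambda>f. restrict f D) -` A \<inter> space \<mu> |A. A \<in> sets (config_space D)}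
      = sigma_sets (space \<mu>) {(\<lambda>f. restrict f D) -` A \<inter> space \<mu> |A. A \<in> ?G1}"
    unfolding sets_PiM_single using r by (rule sigma_sets_vimage_commute)
  have sub1: "{(\<lambda>f. restrict f D) -` A \<inter> space \<mu> |A. A \<in> ?G1} \<subseteq> ?G"
  proof clarify
    fix i and A :: "int set" assume i: "i \<in> D"
    have "(\<lambda>f. restrict f D) -` {f \<in> ?P. f i \<in> A} \<inter> space \<mu>
        = {f \<in> space \<mu>. restrict f {i} \<in> {g. g i \<in> A}}"
      using i by auto
    then show "\<exists>J X. (\<lambda>f. restrict f D) -` {f \<in> ?P. f i \<in> A} \<inter> space \<mu>
        = {f \<in> space \<mu>. restrict f J \<in> X} \<and> finite J \<and> J \<subseteq> D"
      using i by (intro exI[of _ "{i}"] exI[of _ "{g. g i \<in> A}"]) auto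
  qed
  have sub2: "?G \<subseteq> {(\<lambda>f. restrict f D) -` A \<inter> space \<mu> |A. A \<in> sets (config_space D)}"
  proof clarify
    fix J and X :: "(int ^ 'a \<Rightarrow> int) set" assume J: "finite J" "J \<subseteq> D"
    have "{f \<in> space \<mu>. restrict f J \<in> X}
        = (\<lambda>f. restrict f D) -` {f \<in> space (config_space D). restrict f J \<in> X} \<inter> space \<mu>"
      using J(2) by (auto simp: space_PiM restrict_restrict Int_absorb1)
    then show "\<exists>A. {f \<in> space \<mu>. restrict f J \<in> X} = (\<lambda>f. restrict f D) -` A \<inter> space \<mu>
        \<and> A \<in> sets (config_space D)"
      using cylinder_in_sets[OF J, of X] by blast
  qed
  have "sets (sigma_restrict \<mu> D) = {(\<lambda>f. restrict f D) -` A \<inter> space \<mu> |A. A \<in> sets (config_space D)}"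
    unfolding sigma_restrict_def by (intro sets_vimage_algebra2) (auto simp: space_PiM)
  also have "\<dots> = sigma_sets (space \<mu>) ?G"
    unfolding eq
  proof (rule antisym)
    show "sigma_sets (space \<mu>) {(\<lambda>f. restrict f D) -` A \<inter> space \<mu> |A. A \<in> ?G1} \<subseteq> sigma_sets (space \<mu>) ?G"
      using sub1 by (rule sigma_sets_mono')
    show "sigma_sets (space \<mu>) ?G \<subseteq> sigma_sets (space \<mu>) {(\<lambda>f. restrict f D) -` A \<inter> space \<mu> |A. A \<in> ?G1}"
      using sub2 unfolding eq by (rule sigma_sets_mono)
  qed
  finally show ?thesis .
qed

lemma space_sigma_restrict: "space (sigma_restrict \<mu> D) = space \<mu>"
  by (simp add: sigma_restrict_def)

lemma measurable_sigma_restrict_local: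
  assumes "finite J" "J \<subseteq> D" "\<And>x. h x \<in> space N"
  shows "(\<lambda>f. h (restrict f J)) \<in> measurable (sigma_restrict \<mu> D) N"
proof (rule measurableI)
  fix A assume "A \<in> sets N"
  have eq: "(\<lambda>f. h (restrict f J)) -` A \<inter> space (sigma_restrict \<mu> D) = {f \<in> space \<mu>. restrict f J \<in> h -` A}"
    by (auto simp: space_sigma_restrict)
  show "(\<lambda>f. h (restrict f J)) -` A \<inter> space (sigma_restrict \<mu> D) \<in> sets (sigma_restrict \<mu> D)"
    using assms(1,2) unfolding eq sets_sigma_restrict by (intro sigma_sets.Basic) blast
qed (use assms(3) in simp)

lemma Int_stable_cylinders:
  "Int_stable {{f \<in> S. restrict f J \<in> X} |J X. finite J \<and> J \<subseteq> D}"
proof (rule Int_stableI, clarify)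
  fix J K X Y assume JK: "finite J" "J \<subseteq> D" "finite K" "K \<subseteq> D"
  have "{f \<in> S. restrict f J \<in> X} \<inter> {f \<in> S. restrict f K \<in> Y}
      = {f \<in> S. restrict f (J \<union> K) \<in> {g. restrict g J \<in> X \<and> restrict g K \<in> Y}}"
    by (auto simp: restrict_restrict Int_absorb1 Int_absorb2)
  then show "\<exists>Ja Xa. {f \<in> S. restrict f J \<in> X} \<inter> {f \<in> S. restrict f K \<in> Y}
      = {f \<in> S. restrict f Ja \<in> Xa} \<and> finite Ja \<and> Ja \<subseteq> D"
    using JK by (intro exI[of _ "J \<union> K"]) blast
qed

text \<open>The limit is recorded along \<open>even_domains\<close> and for bounded functions of
  finitely many coordinates. Invariance, the DLR equations and convergence along the odd balls each
  follow by passing to the limit in a finite-volume identity.\<close>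

locale limit_measure =
  fixes \<nu> :: "(int ^ 'd \<Rightarrow> int) measure"
  assumes prob_space_nu: "prob_space \<nu>"
    and sets_nu: "sets \<nu> = sets (restrict_space (config_space UNIV) (hom_height UNIV))"
    and lim_nu: "\<And>J g. finite J \<Longrightarrow> bounded (range g) \<Longrightarrow>
      ((\<lambda>\<Lambda>. zero_mean \<Lambda> (\<lambda>f. g (restrict f J))) \<longlongrightarrow> (\<integral>f. g (restrict f J) \<partial>\<nu>)) even_domains"
begin

sublocale prob_space \<nu> by (rule prob_space_nu)

lemma space_nu: "space \<nu> = hom_height UNIV"
  using sets_eq_imp_space_eq[OF sets_nu] by (simp add: space_restrict_space space_PiM)

lemma sets_sigma_restrict_UNIV: "sets (sigma_restrict \<nu> UNIV) = sets \<nu>"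
proof -
  have "sets (sigma_restrict \<nu> UNIV) = {(\<lambda>f. restrict f UNIV) -` A \<inter> space \<nu> |A. A \<in> sets (config_space UNIV)}"
    unfolding sigma_restrict_def by (intro sets_vimage_algebra2) (auto simp: space_PiM)
  also have "\<dots> = sets \<nu>"
    unfolding sets_nu sets_restrict_space by (auto simp: space_nu restrict_UNIV)
  finally show ?thesis .
qed

lemma measurable_local:
  "finite J \<Longrightarrow> (\<And>x. h x \<in> space N) \<Longrightarrow> (\<lambda>f. h (restrict f J)) \<in> measurable \<nu> N"
  using measurable_sigma_restrict_local[of J UNIV h N \<nu>]
  by (simp add: measurable_cong_sets[OF sets_sigma_restrict_UNIV refl])

lemma subalgebra_sigma_restrict: "subalgebra \<nu> (sigma_restrict \<nu> D)"
  unfolding subalgebra_def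
proof
  show "sets (sigma_restrict \<nu> D) \<subseteq> sets \<nu>"
    unfolding sets_sigma_restrict_UNIV[symmetric] sets_sigma_restrict by (rule sigma_sets_mono') auto
qed (simp add: space_sigma_restrict)

lemma integral_local_unique:
  assumes "finite J" "bounded (range g)" "filterlim X even_domains F" "F \<noteq> bot"
    and "((\<lambda>i. zero_mean (X i) (\<lambda>f. g (restrict f J))) \<longlongrightarrow> l) F"
  shows "(\<integral>f. g (restrict f J) \<partial>\<nu>) = l"
  using tendsto_unique[OF assms(4) filterlim_compose[OF lim_nu[OF assms(1,2)] assms(3)] assms(5)] .

lemma bounded_indicator: "bounded (range (indicator X :: _ \<Rightarrow> real))"
  by (rule boundedI[of _ 1]) (auto simp: indicator_def)

lemma measure_cylinder:
  assumes "finite J"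
  shows "measure \<nu> {f \<in> space \<nu>. restrict f J \<in> X} = (\<integral>f. indicator X (restrict f J) \<partial>\<nu>)"
proof -
  define C where "C = {f \<in> space \<nu>. restrict f J \<in> X}"
  have "(\<integral>f. indicator X (restrict f J) \<partial>\<nu>) = (\<integral>f. indicator C f \<partial>\<nu>)"
    by (intro Bochner_Integration.integral_cong) (auto simp: indicator_def C_def)
  also have "\<dots> = measure \<nu> (C \<inter> space \<nu>)" by simp
  also have "C \<inter> space \<nu> = C" by (auto simp: C_def)
  finally show ?thesis unfolding C_def by (rule sym)
qed

text \<open>Shifting the observable by w amounts to shifting the domain by -w, and the shifted
  domains tend along the same filter. So both measures agree on cylinders, which form an
  intersection-stable generator.\<close>

lemma even_translation_invariant_nu: "even_translation_invariant \<nu>"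
  unfolding even_translation_invariant_def
proof
  fix w :: "int ^ 'd" assume w: "w \<in> even_lattice"
  let ?s = "\<lambda>f v. f (v + w)"
  have s: "?s \<in> measurable \<nu> \<nu>"
  proof (subst measurable_cong_sets[OF refl sets_nu], rule measurable_restrict_space2)
    show "?s \<in> space \<nu> \<rightarrow> hom_height UNIV"
      using shift_in_hom_height[OF w] by (auto simp: space_nu)
    show "?s \<in> measurable \<nu> (config_space UNIV)"
    proof (rule measurable_PiM_single')
      fix v :: "int ^ 'd"
      show "(\<lambda>f. f (v + w)) \<in> measurable \<nu> (count_space UNIV)"
        using measurable_local[of "{v + w}" "\<lambda>f. f (v + w)" "count_space UNIV"] by simp
    qed auto
  qed
  interpret s: prob_space "distr \<nu> \<nu> ?s" by (rule prob_space_distr[OF s])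
  let ?E = "{{f \<in> space \<nu>. restrict f J \<in> X} |J X. finite J \<and> J \<subseteq> UNIV}"
  show "distr \<nu> \<nu> ?s = \<nu>"
  proof (rule measure_eqI_generator_eq_countable[where E = ?E and A = "{space \<nu>}" and \<Omega> = "space \<nu>"])
    show "Int_stable ?E" by (rule Int_stable_cylinders)
    show "sets \<nu> = sigma_sets (space \<nu>) ?E" "sets (distr \<nu> \<nu> ?s) = sigma_sets (space \<nu>) ?E"
      using sets_sigma_restrict[of \<nu> UNIV] sets_sigma_restrict_UNIV by simp_all
    show "{space \<nu>} \<subseteq> ?E" by (intro subsetI CollectI exI[of _ "{}"] exI[of _ UNIV]) auto
    fix C assume C: "C \<in> ?E"
    then obtain J X where C_eq: "C = {f \<in> space \<nu>. restrict f J \<in> X}" and J: "finite J" by blast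
    have C_sets: "C \<in> sets \<nu>"
      using C sets_sigma_restrict[of \<nu> UNIV] sets_sigma_restrict_UNIV by auto
    let ?J = "(\<lambda>v. v + w) ` J"
    let ?X = "{h. restrict (?s h) J \<in> X}"
    have res: "restrict (?s (restrict f ?J)) J = restrict (?s f) J" for f :: "int ^ 'd \<Rightarrow> int"
      by (auto simp: fun_eq_iff)
    have "?s -` C \<inter> space \<nu> = {f \<in> space \<nu>. restrict f ?J \<in> ?X}"
      unfolding C_eq mem_Collect_eq res using shift_in_hom_height[OF w] by (auto simp: space_nu)
    then have "measure (distr \<nu> \<nu> ?s) C = measure \<nu> {f \<in> space \<nu>. restrict f ?J \<in> ?X}"
      by (simp only: measure_distr[OF s C_sets])
    also have "\<dots> = (\<integral>f. indicator ?X (restrict f ?J) \<partial>\<nu>)"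
      using J by (intro measure_cylinder) simp
    also have "\<dots> = (\<integral>f. indicator X (restrict f J) \<partial>\<nu>)"
    proof (rule integral_local_unique[OF _ bounded_indicator filterlim_ident even_domains_neq_bot])
      have "zero_mean \<Lambda> (\<lambda>f. indicator ?X (restrict f ?J))
          = zero_mean ((\<lambda>v. v - w) ` \<Lambda>) (\<lambda>f. indicator X (restrict f J))" for \<Lambda>
        using zero_mean_shift[OF w, of \<Lambda> "\<lambda>f. indicator X (restrict f J)"]
        by (simp only: indicator_def mem_Collect_eq res)
      then show "((\<lambda>\<Lambda>. zero_mean \<Lambda> (\<lambda>f. indicator ?X (restrict f ?J)))
          \<longlongrightarrow> (\<integral>f. indicator X (restrict f J) \<partial>\<nu>)) even_domains"
        using filterlim_compose[OF lim_nu[OF J bounded_indicator] filterlim_shift_even_domains[OF w]]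
        by simp
    qed (use J in simp)
    also have "\<dots> = measure \<nu> C"
      using measure_cylinder[OF J] by (simp add: C_eq)
    finally show "emeasure (distr \<nu> \<nu> ?s) C = emeasure \<nu> C"
      by (simp add: emeasure_eq_measure s.emeasure_eq_measure)
  qed auto
qed

text \<open>It suffices that the kernel and the indicator of A have equal integrals over every event
  of the sigma-algebra outside \<Lambda>. Over a cylinder both integrands depend on finitely many
  coordinates, so the finite-volume resampling identity passes to the limit; Dynkin's argument
  extends the equality to all events.\<close>

lemma gibbs_measure_nu: "gibbs_measure \<nu>"
  unfolding gibbs_measure_def
proof (intro conjI allI impI ballI prob_space_nu sets_nu)
  fix \<Lambda> :: "(int ^ 'd) set" and A
  assume \<Lambda>: "finite \<Lambda>" "\<Lambda> \<noteq> {}" and A: "A \<in> sets (config_space (plus_closure \<Lambda>))"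
  let ?F = "sigma_restrict \<nu> (- \<Lambda>)"
  let ?a = "\<lambda>h. indicator A (restrict h (plus_closure \<Lambda>)) :: real"
  define k where "k \<tau> = measure_pmf.prob (finite_volume \<Lambda> \<tau>) A" for \<tau>
  let ?k = "\<lambda>f. k (restrict f (outer_boundary \<Lambda>))"
  have k01: "0 \<le> k \<tau>" "k \<tau> \<le> 1" for \<tau> by (auto simp: k_def)
  have bd_sub: "outer_boundary \<Lambda> \<subseteq> - \<Lambda>" by (auto simp: outer_boundary_def)
  interpret finite_measure_subalgebra \<nu> ?F
    by unfold_locales (rule subalgebra_sigma_restrict)
  have k_meas: "?k \<in> borel_measurable ?F"
    using finite_outer_boundary[OF \<Lambda>(1)] bd_sub by (intro measurable_sigma_restrict_local) auto
  have int_a: "integrable \<nu> ?a"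
    using finite_plus_closure[OF \<Lambda>(1)]
    by (intro integrable_const_bound[of _ 1] measurable_local) (auto simp: indicator_def)
  have int_k: "integrable \<nu> ?k"
    using finite_outer_boundary[OF \<Lambda>(1)] k01
    by (intro integrable_const_bound[of _ 1] measurable_local) auto
  have set_int: "set_integrable \<nu> B ?a" "set_integrable \<nu> B ?k" if "B \<in> sets \<nu>" for B
    unfolding set_integrable_def using that int_a int_k by (intro integrable_mult_indicator; simp)+
  let ?G = "{{f \<in> space \<nu>. restrict f J \<in> X} |J X. finite J \<and> J \<subseteq> - \<Lambda>}"
  have G_sub: "?G \<subseteq> Pow (space \<nu>)" by auto
  have F_sub: "B \<in> sets \<nu>" if "B \<in> sigma_sets (space \<nu>) ?G" for B
    using that subalgebra_sigma_restrict[of "- \<Lambda>"] sets_sigma_restrict[of \<nu> "- \<Lambda>"]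
    by (auto simp: subalgebra_def)
  have cyl: "(LINT f:{f \<in> space \<nu>. restrict f J \<in> X}|\<nu>. ?a f) = (LINT f:{f \<in> space \<nu>. restrict f J \<in> X}|\<nu>. ?k f)"
    if J: "finite J" "J \<subseteq> - \<Lambda>" for J X
  proof -
    let ?I = "\<lambda>f. indicator X (restrict f J) :: real"
    \<comment> \<open>One finite window that determines the cylinder event, the configuration on the
      closure of \<Lambda> and the boundary values, so that both integrands become local functions
      of it.\<close>
    define K where "K = J \<union> plus_closure \<Lambda>"
    have K: "finite K" using J \<Lambda> by (simp add: K_def finite_plus_closure)
    have sub: "J \<inter> K = J" "plus_closure \<Lambda> \<inter> K = plus_closure \<Lambda>" "outer_boundary \<Lambda> \<inter> K = outer_boundary \<Lambda>"
      "K \<inter> J = J" "K \<inter> plus_closure \<Lambda> = plus_closure \<Lambda>" "K \<inter> outer_boundary \<Lambda> = outer_boundary \<Lambda>"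
      by (auto simp: K_def plus_closure_def)
    have "(LINT f:{f \<in> space \<nu>. restrict f J \<in> X}|\<nu>. ?a f) = (\<integral>f. ?a (restrict f K) * ?I (restrict f K) \<partial>\<nu>)"
      unfolding set_lebesgue_integral_def
      by (intro Bochner_Integration.integral_cong) (auto simp: indicator_def sub)
    also have "\<dots> = (\<integral>f. ?k (restrict f K) * ?I (restrict f K) \<partial>\<nu>)"
    proof (rule integral_local_unique[OF K _ filterlim_ident even_domains_neq_bot,
          where g = "\<lambda>h. ?a h * ?I h"])
      show "bounded (range (\<lambda>h. ?a h * ?I h))"
        by (rule boundedI[of _ 1]) (auto simp: indicator_def)
      have "bounded (range (\<lambda>h. ?k h * ?I h))"
        by (rule boundedI[of _ 1]) (use k01 in \<open>auto simp: indicator_def\<close>)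
      from lim_nu[OF K this]
      have "((\<lambda>\<Lambda>'. zero_mean \<Lambda>' (\<lambda>f. ?k (restrict f K) * ?I (restrict f K)))
          \<longlongrightarrow> (\<integral>f. ?k (restrict f K) * ?I (restrict f K) \<partial>\<nu>)) even_domains" .
      moreover have "\<forall>\<^sub>F \<Lambda>' in even_domains. zero_mean \<Lambda>' (\<lambda>f. ?k (restrict f K) * ?I (restrict f K))
          = zero_mean \<Lambda>' (\<lambda>f. ?a (restrict f K) * ?I (restrict f K))"
        unfolding eventually_even_domains
      \<comment> \<open>Resampling is exact as soon as \<Lambda>' contains \<Lambda>, and it applies
        to \<open>?I\<close> because J lies outside \<Lambda>.\<close>
      proof (intro exI[of _ \<Lambda>] conjI allI impI \<Lambda>(1))
        fix \<Lambda>' :: "(int ^ 'd) set" assume "even_domain \<Lambda>'" and sub': "\<Lambda> \<subseteq> \<Lambda>'"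
        then have fin': "finite \<Lambda>'" by (simp add: even_domain_def)
        have "?I f = ?I g" if "\<And>v. v \<notin> \<Lambda> \<Longrightarrow> f v = g v" for f g
        proof -
          have "restrict f J = restrict g J" using that J(2) by (auto simp: fun_eq_iff restrict_def)
          then show ?thesis by simp
        qed
        from zero_mean_resample[OF sub' fin', of ?I A, OF this]
        show "zero_mean \<Lambda>' (\<lambda>f. ?k (restrict f K) * ?I (restrict f K))
            = zero_mean \<Lambda>' (\<lambda>f. ?a (restrict f K) * ?I (restrict f K))"
          by (simp add: sub k_def)
      qed
      ultimately show "((\<lambda>\<Lambda>'. zero_mean \<Lambda>' (\<lambda>f. ?a (restrict f K) * ?I (restrict f K)))
          \<longlongrightarrow> (\<integral>f. ?k (restrict f K) * ?I (restrict f K) \<partial>\<nu>)) even_domains"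
        by (rule Lim_transform_eventually)
    qed
    also have "\<dots> = (LINT f:{f \<in> space \<nu>. restrict f J \<in> X}|\<nu>. ?k f)"
      unfolding set_lebesgue_integral_def
      by (intro Bochner_Integration.integral_cong) (auto simp: indicator_def sub)
    finally show ?thesis .
  qed
  have "(LINT f:B|\<nu>. ?a f) = (LINT f:B|\<nu>. ?k f)" if "B \<in> sigma_sets (space \<nu>) ?G" for B
    using Int_stable_cylinders[of "space \<nu>" "- \<Lambda>"] G_sub that
  proof (induction rule: sigma_sets_induct_disjoint)
    case (basic B)
    then obtain J X where B: "B = {f \<in> space \<nu>. restrict f J \<in> X}" "finite J" "J \<subseteq> - \<Lambda>" by blast
    show ?case unfolding B(1) using B(2,3) by (rule cyl)
  next
    case (compl B)
    have B: "B \<in> sets \<nu>" by (rule F_sub[OF compl(1)])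
    \<comment> \<open>The whole space is the cylinder over the empty set; subtracting B from it
      yields the complement.\<close>
    have total: "(LINT f:space \<nu>|\<nu>. ?a f) = (LINT f:space \<nu>|\<nu>. ?k f)"
      using cyl[of "{}" UNIV] by simp
    have split: "(LINT f:space \<nu>|\<nu>. g f) = (LINT f:B|\<nu>. g f) + (LINT f:(space \<nu> - B)|\<nu>. g f)"
      if "set_integrable \<nu> B g" "set_integrable \<nu> (space \<nu> - B) g" for g :: "_ \<Rightarrow> real"
    proof -
      have "B \<union> (space \<nu> - B) = space \<nu>" using sets.sets_into_space[OF B] by blast
      then show ?thesis using set_integral_Un[of B "space \<nu> - B" \<nu> g] that by auto
    qed
    have Bc: "space \<nu> - B \<in> sets \<nu>" using B by blast
    show ?case
      using total compl(2) split[OF set_int(1)[OF B] set_int(1)[OF Bc]]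
        split[OF set_int(2)[OF B] set_int(2)[OF Bc]]
      by linarith
  next
    case (union B)
    have "B i \<in> sets \<nu>" for i using union(2) F_sub by blast
    then have B: "\<And>i. B i \<in> sets \<nu>" "(\<Union>i. B i) \<in> sets \<nu>" by auto
    have disj: "B i \<inter> B j = {}" if "i \<noteq> j" for i j
      using union(1) that by (auto simp: disjoint_family_on_def)
    have "(LINT f:(\<Union>i. B i)|\<nu>. ?a f) = (\<Sum>i. LINT f:B i|\<nu>. ?a f)"
      by (rule lebesgue_integral_countable_add[OF B(1) disj set_int(1)[OF B(2)]])
    also have "\<dots> = (\<Sum>i. LINT f:B i|\<nu>. ?k f)"
      by (simp only: union(3))
    also have "\<dots> = (LINT f:(\<Union>i. B i)|\<nu>. ?k f)"
      by (rule lebesgue_integral_countable_add[OF B(1) disj set_int(2)[OF B(2)], symmetric])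
    finally show ?case .
  qed (simp add: set_lebesgue_integral_def)
  then have "AE f in \<nu>. real_cond_exp \<nu> ?F ?a f = ?k f"
    using k_meas int_a int_k by (intro real_cond_exp_charact) (auto simp: sets_sigma_restrict)
  then show "AE f in \<nu>. real_cond_exp \<nu> ?F ?a f
      = measure_pmf.prob (finite_volume \<Lambda> (restrict f (outer_boundary \<Lambda>))) A"
    by (simp add: k_def)
qed

lemma converges_in_distribution_nu:
  assumes P: "\<And>n. P n = finite_volume (ball1 (2 * n + 1)) (\<lambda>_. 0)"
  shows "converges_in_distribution P \<nu>"
  unfolding converges_in_distribution_def
proof (intro allI impI)
  fix D :: "(int ^ 'd) set" and g :: "(int ^ 'd \<Rightarrow> int) \<Rightarrow> real"
  assume D: "finite D" and g: "bounded (range g)"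
  have r: "(\<lambda>f. restrict f D) \<in> measurable \<nu> (config_space D)"
    using measurable_local[OF D, of "\<lambda>f. restrict f D" "config_space D"] by (simp add: space_PiM)
  have "g \<in> borel_measurable (config_space D)"
    using D by (simp add: count_space_PiM_finite)
  then have eq: "(\<integral>f. g f \<partial>distr \<nu> (config_space D) (\<lambda>f. restrict f D)) = (\<integral>f. g (restrict f D) \<partial>\<nu>)"
    by (rule integral_distr[OF r])
  obtain N where N: "\<And>n. N \<le> n \<Longrightarrow> D \<subseteq> ball1 n" using D by (rule finite_subset_ball1) blast
  have "\<forall>\<^sub>F n in sequentially. zero_mean (ball1 (2 * n + 1)) (\<lambda>f. g (restrict f D))
      = (\<integral>f. g f \<partial>measure_pmf (map_pmf (\<lambda>f. restrict f D) (P n)))"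
    using eventually_ge_at_top[of N]
  proof eventually_elim
    case (elim n)
    have "D \<subseteq> ball1 (2 * n + 1)" using elim by (intro N) simp
    then have "plus_closure (ball1 (2 * n + 1)) \<inter> D = D" by (auto simp: plus_closure_def)
    then show ?case
      by (simp add: P finite_volume_zero even_domain_ball1 zero_mean_eq_integral finite_ball1)
  qed
  with filterlim_compose[OF lim_nu[OF D g] filterlim_ball1]
  show "(\<lambda>n. \<integral>f. g f \<partial>measure_pmf (map_pmf (\<lambda>f. restrict f D) (P n)))
      \<longlonglongrightarrow> (\<integral>f. g f \<partial>distr \<nu> (config_space D) (\<lambda>f. restrict f D))"
    unfolding eq by (rule Lim_transform_eventually)
qed

end

text \<open>Uniqueness of limits makes the limiting marginals consistent, so they extend to a
  measure on all integer-valued functions. Being a height function is a countable conjunction of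
  conditions on pairs of vertices, each satisfied in every finite volume; hence it holds almost
  surely and the measure may be restricted to \<open>hom_height UNIV\<close>.\<close>

lemma ex_limit_measure:
  assumes tight: "\<And>\<epsilon>. 0 < \<epsilon> \<Longrightarrow>
      \<exists>M. \<forall>n. zero_mean (ball1 (2 * n + 1) :: (int ^ 'd) set) (\<lambda>f. of_bool (M < \<bar>f 0\<bar>)) \<le> \<epsilon>"
  obtains \<nu> :: "(int ^ 'd \<Rightarrow> int) measure" where "limit_measure \<nu>"
proof -
  have "\<forall>D :: (int ^ 'd) set. \<exists>q. finite D \<longrightarrow> (\<forall>g :: (int ^ 'd \<Rightarrow> int) \<Rightarrow> real. bounded (range g) \<longrightarrow>
      ((\<lambda>\<Lambda>. zero_mean \<Lambda> (\<lambda>f. g (restrict f D))) \<longlongrightarrow> measure_pmf.expectation q g) even_domains)"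
    using ex_limit_marginal[OF tight] by meson
  then obtain q where q: "((\<lambda>\<Lambda>. zero_mean \<Lambda> (\<lambda>f. g (restrict f D))) \<longlongrightarrow> measure_pmf.expectation (q D) g) even_domains"
    if "finite D" "bounded (range g)" for D :: "(int ^ 'd) set" and g :: "(int ^ 'd \<Rightarrow> int) \<Rightarrow> real"
    by metis
  have bi: "bounded (range (indicator X :: (int ^ 'd \<Rightarrow> int) \<Rightarrow> real))" for X
    by (rule boundedI[of _ 1]) (auto simp: indicator_def)
  have proj: "q J = map_pmf (\<lambda>f. restrict f J) (q H)" if JH: "J \<subseteq> H" "finite H" for J H
  proof (rule pmf_eqI)
    fix x :: "int ^ 'd \<Rightarrow> int"
    have E: "measure_pmf.expectation p (indicator {x}) = pmf p x" for p
      by (simp add: measure_pmf_single)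
    let ?h = "\<lambda>f :: int ^ 'd \<Rightarrow> int. indicator {x} (restrict f J) :: real"
    have "((\<lambda>\<Lambda>. zero_mean \<Lambda> ?h) \<longlongrightarrow> measure_pmf.expectation (q J) (indicator {x})) even_domains"
      using q[OF finite_subset[OF JH] bi] .
    moreover have "bounded (range ?h)"
      by (rule boundedI[of _ 1]) (auto simp: indicator_def)
    then have "((\<lambda>\<Lambda>. zero_mean \<Lambda> ?h) \<longlongrightarrow> measure_pmf.expectation (q H) ?h) even_domains"
      using q[OF JH(2), of ?h] JH(1) by (simp add: Int_absorb1)
    ultimately have "measure_pmf.expectation (q J) (indicator {x}) = measure_pmf.expectation (q H) ?h"
      by (rule tendsto_unique[OF even_domains_neq_bot])
    also have "\<dots> = measure_pmf.expectation (map_pmf (\<lambda>f. restrict f J) (q H)) (indicator {x})"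
      by (simp only: integral_map_pmf)
    finally show "pmf (q J) x = pmf (map_pmf (\<lambda>f. restrict f J) (q H)) x"
      by (simp only: E)
  qed
  obtain \<mu> where \<mu>: "prob_space \<mu>" "sets \<mu> = sets (config_space UNIV)"
    and cyl: "\<And>J X. finite J \<Longrightarrow> measure \<mu> {f. restrict f J \<in> X} = measure_pmf.prob (q J) X"
    using ex_projective_limit_pmf[OF proj] by blast
  interpret prob_space \<mu> by fact
  have space: "space \<mu> = UNIV" using sets_eq_imp_space_eq[OF \<mu>(2)] by (simp add: space_PiM)
  have cyl_sets: "{f. restrict f J \<in> X} \<in> sets \<mu>" if "finite J" for J X
    using cylinder_in_sets[OF that subset_UNIV, of X] by (simp add: \<mu>(2) space_PiM)
  define Bad :: "int ^ 'd \<Rightarrow> int ^ 'd \<Rightarrow> (int ^ 'd \<Rightarrow> int) set"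
    where "Bad u v = {f. \<not> (\<bar>f u - f v\<bar> \<le> norm1 (u - v) \<and> f v mod 2 = norm1 v mod 2)}" for u v
  have hom_iff: "f \<in> hom_height UNIV \<longleftrightarrow> (\<forall>x. restrict f {fst x, snd x} \<notin> Bad (fst x) (snd x))" for f
    by (auto simp: hom_height_def Bad_def)
  have "AE f in \<mu>. restrict f {fst x, snd x} \<notin> Bad (fst x) (snd x)" for x
  proof -
    let ?J = "{fst x, snd x}" and ?X = "Bad (fst x) (snd x)"
    have "zero_mean \<Lambda> (\<lambda>f. indicator ?X (restrict f ?J)) = 0" for \<Lambda>
      using hom_iff by (auto simp: zero_mean_def zero_homs_def intro!: sum.neutral)
    then have "((\<lambda>_. 0) \<longlongrightarrow> measure_pmf.prob (q ?J) ?X) (even_domains :: (int ^ 'd) set filter)"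
      using q[OF _ bi, of ?J ?X] by simp
    then have "measure_pmf.prob (q ?J) ?X = 0"
      using tendsto_unique[OF even_domains_neq_bot tendsto_const] by metis
    then have "{f. restrict f ?J \<in> ?X} \<in> null_sets \<mu>"
      using cyl[of ?J ?X] cyl_sets[of ?J ?X] by (simp add: null_sets_def emeasure_eq_measure)
    then show ?thesis by (rule AE_I') auto
  qed
  then have AE_hom: "AE f in \<mu>. f \<in> hom_height UNIV"
    unfolding hom_iff AE_all_countable by blast
  have "hom_height UNIV = (\<Inter>x. UNIV - {f. restrict f {fst x, snd x} \<in> Bad (fst x) (snd x)})"
    using hom_iff by auto
  also have "\<dots> \<in> sets \<mu>"
    using sets.top[of \<mu>] cyl_sets by (intro sets.countable_INT' sets.Diff) (auto simp: space)
  finally have hom_sets: "hom_height UNIV \<in> sets \<mu>" .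
  define \<nu> where "\<nu> = restrict_space \<mu> (hom_height UNIV)"
  have "limit_measure \<nu>"
  proof (rule limit_measure.intro)
    have "emeasure \<mu> (hom_height UNIV) = 1"
      using AE_hom hom_sets by (simp add: emeasure_eq_measure prob_eq_1)
    then show "prob_space \<nu>"
      unfolding \<nu>_def using hom_sets by (intro prob_space_restrict_space)
    show "sets \<nu> = sets (restrict_space (config_space UNIV) (hom_height UNIV))"
      unfolding \<nu>_def using \<mu>(2) by (rule sets_restrict_space_cong)
    fix J :: "(int ^ 'd) set" and g :: "(int ^ 'd \<Rightarrow> int) \<Rightarrow> real" assume J: "finite J" and g: "bounded (range g)"
    have r: "(\<lambda>f. restrict f J) \<in> measurable \<mu> (count_space UNIV)"
      using cyl_sets[OF J] by (intro measurableI) (auto simp: vimage_def space)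
    have distr: "distr \<mu> (count_space UNIV) (\<lambda>f. restrict f J) = measure_pmf (q J)"
    proof (rule measure_eqI)
      fix X
      interpret d: prob_space "distr \<mu> (count_space UNIV) (\<lambda>f. restrict f J)"
        by (rule prob_space_distr[OF r])
      show "emeasure (distr \<mu> (count_space UNIV) (\<lambda>f. restrict f J)) X = emeasure (measure_pmf (q J)) X"
        using cyl[OF J, of X] r
        by (simp add: d.emeasure_eq_measure measure_pmf.emeasure_eq_measure measure_distr space vimage_def)
    qed simp
    have r': "(\<lambda>f. g (restrict f J)) \<in> borel_measurable \<mu>"
      using measurable_compose[OF r, of g borel] by simp
    have "(\<integral>f. g (restrict f J) \<partial>\<nu>) = (\<integral>f. g (restrict f J) \<partial>\<mu>)"
      unfolding \<nu>_def using hom_sets AE_hom r'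
      by (subst integral_restrict_space) (auto simp: space intro!: integral_cong_AE)
    also have "\<dots> = measure_pmf.expectation (q J) g"
      unfolding distr[symmetric] by (rule integral_distr[symmetric, OF r]) simp
    finally show "((\<lambda>\<Lambda>. zero_mean \<Lambda> (\<lambda>f. g (restrict f J))) \<longlongrightarrow> (\<integral>f. g (restrict f J) \<partial>\<nu>)) even_domains"
      using q[OF J g] by simp
  qed
  then show ?thesis by (rule that)
qed

section \<open>The dichotomy\<close>

lemma antimono_convergent_at_top:
  fixes h :: "real \<Rightarrow> real"
  assumes "antimono h" "\<And>x. 0 \<le> h x"
  obtains c where "0 \<le> c" "(h \<longlongrightarrow> c) at_top"
proof -
  have bdd: "bdd_below (range h)" using assms(2) by (intro bdd_belowI[of _ 0]) auto
  have "(h \<longlongrightarrow> Inf (range h)) at_top"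
  proof (rule order_tendstoI)
    fix y assume "y < Inf (range h)"
    then have "y < h x" for x using cInf_lower[OF rangeI bdd, of x] by simp
    then show "\<forall>\<^sub>F x in at_top. y < h x" by simp
  next
    fix y assume "Inf (range h) < y"
    then obtain x where x: "h x < y" using cInf_less_iff[OF _ bdd] by auto
    have "h z < y" if "x \<le> z" for z
      using antimonoD[OF assms(1) that] x by simp
    then show "\<forall>\<^sub>F z in at_top. h z < y"
      unfolding eventually_at_top_linorder by blast
  qed
  moreover have "0 \<le> Inf (range h)" using assms(2) by (intro cInf_greatest) auto
  ultimately show ?thesis using that by blast
qed

lemma prob_abs_gt_0:
  assumes "odd L"
  shows "measure_pmf.prob (finite_volume (ball1 L :: (int ^ 'd) set) (\<lambda>_. 0)) {f. M < real_of_int \<bar>f 0\<bar>}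
    = zero_mean (ball1 L :: (int ^ 'd) set) (\<lambda>f. of_bool (M < real_of_int \<bar>f 0\<bar>))"
proof -
  define S where "S = {f :: int ^ 'd \<Rightarrow> int. M < real_of_int \<bar>f 0\<bar>}"
  have "0 \<in> plus_closure (ball1 L :: (int ^ 'd) set)"
    by (simp add: plus_closure_def ball1_def)
  then have "measure_pmf.prob (finite_volume (ball1 L) (\<lambda>_. 0)) S
      = measure_pmf.prob (pmf_of_set (zero_homs (ball1 L))) S"
    by (simp add: finite_volume_zero[OF even_domain_ball1[OF assms]] vimage_def S_def)
  also have "\<dots> = measure_pmf.expectation (pmf_of_set (zero_homs (ball1 L))) (indicator S)"
    by simp
  also have "\<dots> = zero_mean (ball1 L) (indicator S)"
    by (simp add: zero_mean_eq_integral finite_ball1)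
  also have "indicator S = (\<lambda>f. of_bool (M < real_of_int \<bar>f 0\<bar>) :: real)"
    by (auto simp: S_def indicator_def)
  finally show ?thesis unfolding S_def .
qed

text \<open>The limiting law at the origin is a probability, so one threshold makes the tails small
  for all large n. The finitely many remaining laws have finite support, and a larger threshold
  excludes them completely.\<close>

lemma tight_of_converges:
  fixes \<mu> :: "(int ^ 'd \<Rightarrow> int) measure" and P :: "nat \<Rightarrow> (int ^ 'd \<Rightarrow> int) pmf"
  assumes gibbs: "gibbs_measure \<mu>" and conv: "converges_in_distribution P \<mu>"
    and fin: "\<And>n. finite (set_pmf (P n))" and \<epsilon>: "0 < \<epsilon>"
  obtains M :: real where "\<And>n. measure_pmf.prob (P n) {f. M < real_of_int \<bar>f 0\<bar>} \<le> \<epsilon>"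
proof -
  interpret prob_space \<mu> using gibbs by (simp add: gibbs_measure_def)
  let ?D = "{0 :: int ^ 'd}"
  let ?S = "\<lambda>M :: real. {f :: int ^ 'd \<Rightarrow> int. M < real_of_int \<bar>f 0\<bar>}"
  define m where "m = distr \<mu> (config_space ?D) (\<lambda>f. restrict f ?D)"
  have "sets \<mu> = sets (restrict_space (config_space UNIV) (hom_height UNIV))"
    using gibbs by (simp add: gibbs_measure_def)
  then have r: "(\<lambda>f. restrict f ?D) \<in> measurable \<mu> (config_space ?D)"
    by (subst measurable_cong_sets[OF _ refl])
      (auto intro!: measurable_restrict_space1 measurable_restrict_subset)
  interpret m: prob_space m unfolding m_def by (rule prob_space_distr[OF r])
  have space_m: "space m = PiE ?D (\<lambda>_. UNIV)" by (simp add: m_def space_PiM)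
  have sets_m: "sets m = Pow (PiE ?D (\<lambda>_. UNIV))"
    by (simp add: m_def count_space_PiM_finite)
  have "(\<lambda>k. measure m (?S (real k) \<inter> space m)) \<longlonglongrightarrow> measure m (\<Inter>k. ?S (real k) \<inter> space m)"
    by (intro m.finite_Lim_measure_decseq) (auto simp: sets_m space_m decseq_def)
  also have "(\<Inter>k. ?S (real k) \<inter> space m) = {}"
  proof -
    have "f \<notin> (\<Inter>k. ?S (real k) \<inter> space m)" for f
      using real_arch_simple[of "real_of_int \<bar>f 0\<bar>"] by (auto simp: not_less)
    then show ?thesis by blast
  qed
  finally have "(\<lambda>k. measure m (?S (real k) \<inter> space m)) \<longlonglongrightarrow> 0" by simp
  then have "\<forall>\<^sub>F k in sequentially. measure m (?S (real k) \<inter> space m) < \<epsilon>"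
    using \<epsilon> by (rule order_tendstoD)
  then obtain k where k: "measure m (?S (real k) \<inter> space m) < \<epsilon>"
    using eventually_happens'[OF sequentially_bot] by blast
  let ?g = "indicator (?S (real k)) :: _ \<Rightarrow> real"
  have "bounded (range ?g)"
    by (rule boundedI[of _ 1]) (auto simp: indicator_def)
  then have "(\<lambda>n. \<integral>f. ?g f \<partial>measure_pmf (map_pmf (\<lambda>f. restrict f ?D) (P n))) \<longlonglongrightarrow> (\<integral>f. ?g f \<partial>m)"
    using conv unfolding converges_in_distribution_def m_def by (metis finite.emptyI finite_insert)
  moreover have "(\<integral>f. ?g f \<partial>m) = measure m (?S (real k) \<inter> space m)" by simp
  moreover have "(\<integral>f. ?g f \<partial>measure_pmf (map_pmf (\<lambda>f. restrict f ?D) (P n))) = measure_pmf.prob (P n) (?S (real k))" for n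
  proof -
    have "(\<integral>f. ?g f \<partial>measure_pmf (map_pmf (\<lambda>f. restrict f ?D) (P n)))
        = measure_pmf.prob (map_pmf (\<lambda>f. restrict f ?D) (P n)) (?S (real k))" by (simp del: integral_map_pmf measure_map_pmf)
    also have "\<dots> = measure_pmf.prob (P n) (?S (real k))" by (simp add: vimage_def)
    finally show ?thesis .
  qed
  ultimately have "\<forall>\<^sub>F n in sequentially. measure_pmf.prob (P n) (?S (real k)) < \<epsilon>"
    using k by (intro order_tendstoD(2)) auto
  then obtain N where N: "\<And>n. N \<le> n \<Longrightarrow> measure_pmf.prob (P n) (?S (real k)) < \<epsilon>"
    by (auto simp: eventually_sequentially)
  \<comment> \<open>\<open>b n\<close> bounds |f 0| on the support of \<open>P n\<close>, and by
    non-negativity the sum of all \<open>b n\<close> with n < N bounds the exceptional laws at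
    once.\<close>
  define b where "b n = (\<Sum>f\<in>set_pmf (P n). \<bar>f 0\<bar>)" for n
  have b: "0 \<le> b n" for n by (simp add: b_def sum_nonneg)
  show ?thesis
  proof (rule that)
    fix n
    let ?M = "real k + real_of_int (\<Sum>n<N. b n)"
    have "0 \<le> (\<Sum>n<N. b n)" using b by (simp add: sum_nonneg)
    show "measure_pmf.prob (P n) (?S ?M) \<le> \<epsilon>"
    proof (cases "n < N")
      case True
      have "b n \<le> (\<Sum>n<N. b n)" using True b by (intro member_le_sum) auto
      moreover have "\<bar>f 0\<bar> \<le> b n" if "f \<in> set_pmf (P n)" for f
        unfolding b_def using that fin by (intro member_le_sum) auto
      ultimately have "\<bar>f 0\<bar> \<le> (\<Sum>n<N. b n)" if "f \<in> set_pmf (P n)" for f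
        using that by (meson order_trans)
      then have "real_of_int \<bar>f 0\<bar> \<le> ?M" if "f \<in> set_pmf (P n)" for f
        using that by (smt (verit) of_int_le_iff of_nat_0_le_iff)
      then have "set_pmf (P n) \<inter> ?S ?M = {}"
        unfolding disjoint_iff mem_Collect_eq not_less by blast
      then have "measure_pmf.prob (P n) (?S ?M) = 0" by (simp add: measure_pmf_zero_iff)
      then show ?thesis using \<epsilon> by simp
    next
      case False
      have "real k \<le> ?M" using \<open>0 \<le> (\<Sum>n<N. b n)\<close> by (simp only: le_add_same_cancel1 of_int_0_le_iff)
      then have "?S ?M \<subseteq> ?S (real k)" by (intro Collect_mono impI) (rule le_less_trans)
      then have "measure_pmf.prob (P n) (?S ?M) \<le> measure_pmf.prob (P n) (?S (real k))"
        by (intro measure_pmf.finite_measure_mono) auto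
      then show ?thesis using N[of n] False by simp
    qed
  qed
qed

theorem theorem1p1:
  fixes \<mu>L :: "nat \<Rightarrow> (int ^ 'd \<Rightarrow> int) pmf"
  assumes "\<And>L. odd L \<Longrightarrow> \<mu>L L = finite_volume (ball1 L) (\<lambda>_. 0)"
  shows "(\<exists>c>0. ((\<lambda>M::real. SUP L\<in>{L. odd L}. measure_pmf.prob (\<mu>L L) {f. real_of_int \<bar>f 0\<bar> > M})
                   \<longlongrightarrow> c) at_top)
         \<longleftrightarrow> \<not> (\<exists>\<mu>. gibbs_measure \<mu> \<and> even_translation_invariant \<mu> \<and>
                  converges_in_distribution (\<lambda>n. \<mu>L (2 * n + 1)) \<mu>)"
proof -
  let ?p = "\<lambda>M L. measure_pmf.prob (\<mu>L L) {f. M < real_of_int \<bar>f 0\<bar>}"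
  let ?h = "\<lambda>M. SUP L\<in>{L. odd L}. ?p M L"
  have bdd: "bdd_above (?p M ` {L. odd L})" for M by (intro bdd_aboveI[of _ 1]) auto
  have ne: "{L :: nat. odd L} \<noteq> {}" by (auto intro: exI[of _ 1])
  have h_upper: "?p M L \<le> ?h M" if "odd L" for M L
    using that by (intro cSUP_upper bdd) simp
  have h_least: "?h M \<le> x" if "\<And>L. odd L \<Longrightarrow> ?p M L \<le> x" for M x
    using that ne by (intro cSUP_least) auto
  have anti: "antimono ?h"
  proof (rule antimonoI)
    fix M M' :: real assume "M \<le> M'"
    then have "?p M' L \<le> ?p M L" for L
      by (intro measure_pmf.finite_measure_mono) auto
    then show "?h M' \<le> ?h M" using h_upper by (intro h_least) (meson order_trans)
  qed
  have h_nonneg: "0 \<le> ?h M" for M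
    using h_upper[of 1 M] measure_nonneg by (meson odd_one order_trans)
  \<comment> \<open>The supremum is antitone and non-negative in M, so its limit exists in any case.
    The first alternative then reads c > 0, and c = 0 has to be matched with convergence.\<close>
  obtain c where c: "0 \<le> c" "(?h \<longlongrightarrow> c) at_top"
    using antimono_convergent_at_top[OF anti h_nonneg] .
  have iff: "(\<exists>c>0. (?h \<longlongrightarrow> c) at_top) \<longleftrightarrow> c \<noteq> 0"
    using c tendsto_unique[OF trivial_limit_at_top_linorder c(2)] by (metis less_le)
  have P: "\<mu>L (2 * n + 1) = finite_volume (ball1 (2 * n + 1)) (\<lambda>_. 0)" for n
    using assms by simp
  have "c = 0 \<longleftrightarrow> (\<exists>\<mu>. gibbs_measure \<mu> \<and> even_translation_invariant \<mu> \<and>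
      converges_in_distribution (\<lambda>n. \<mu>L (2 * n + 1)) \<mu>)"
  proof
    assume "c = 0"
    have "\<exists>M. \<forall>n. zero_mean (ball1 (2 * n + 1) :: (int ^ 'd) set) (\<lambda>f. of_bool (M < \<bar>f 0\<bar>)) \<le> \<epsilon>"
      if "0 < \<epsilon>" for \<epsilon>
    proof -
      have "\<forall>\<^sub>F M in at_top. ?h M < \<epsilon>"
        using order_tendstoD(2)[OF c(2)] \<open>c = 0\<close> that by simp
      then obtain M where M: "?h M < \<epsilon>"
        using eventually_happens'[OF trivial_limit_at_top_linorder] by blast
      \<comment> \<open>The threshold is rounded up to an integer, because
        \<open>ex_limit_measure\<close> compares heights with integers; rounding up can only lower
        the supremum.\<close>
      have "?h (real_of_int \<lceil>M\<rceil>) \<le> ?h M" by (intro antimonoD[OF anti]) simp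
      then have *: "?p (real_of_int \<lceil>M\<rceil>) (2 * n + 1) \<le> \<epsilon>" for n
        using h_upper[of "2 * n + 1" "real_of_int \<lceil>M\<rceil>"] M by simp
      have "zero_mean (ball1 (2 * n + 1) :: (int ^ 'd) set) (\<lambda>f. of_bool (\<lceil>M\<rceil> < \<bar>f 0\<bar>)) \<le> \<epsilon>" for n
      proof -
        have "odd (2 * n + 1)" by simp
        from *[of n] show ?thesis
          unfolding P prob_abs_gt_0[OF \<open>odd (2 * n + 1)\<close>] by (simp only: of_int_less_iff)
      qed
      then show ?thesis by blast
    qed
    then obtain \<nu> :: "(int ^ 'd \<Rightarrow> int) measure" where "limit_measure \<nu>"
      by (rule ex_limit_measure)
    then show "\<exists>\<mu>. gibbs_measure \<mu> \<and> even_translation_invariant \<mu> \<and>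
        converges_in_distribution (\<lambda>n. \<mu>L (2 * n + 1)) \<mu>"
      using limit_measure.gibbs_measure_nu limit_measure.even_translation_invariant_nu
        limit_measure.converges_in_distribution_nu[OF _ P] by blast
  next
    assume "\<exists>\<mu>. gibbs_measure \<mu> \<and> even_translation_invariant \<mu> \<and>
        converges_in_distribution (\<lambda>n. \<mu>L (2 * n + 1)) \<mu>"
    then obtain \<mu> where \<mu>: "gibbs_measure \<mu>" "converges_in_distribution (\<lambda>n. \<mu>L (2 * n + 1)) \<mu>"
      by blast
    have fin: "finite (set_pmf (\<mu>L (2 * n + 1)))" for n
      unfolding P by (simp add: finite_volume_zero even_domain_ball1 zero_homs_nonempty finite_zero_homs finite_ball1)
    \<comment> \<open>Every odd L has the form 2 n + 1, so a threshold uniform in n bounds the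
      supremum over L, and being antitone the supremum stays below \<epsilon> from there on.\<close>
    have "c \<le> \<epsilon>" if \<epsilon>: "0 < \<epsilon>" for \<epsilon>
    proof -
      obtain M where M: "\<And>n. ?p M (2 * n + 1) \<le> \<epsilon>"
        using tight_of_converges[OF \<mu> fin \<epsilon>] by blast
      have "?h M \<le> \<epsilon>"
      proof (rule h_least)
        fix L :: nat assume "odd L"
        then obtain n where "L = 2 * n + 1" by (rule oddE)
        then show "?p M L \<le> \<epsilon>" using M by simp
      qed
      have "\<forall>\<^sub>F M' in at_top. ?h M' \<le> \<epsilon>"
        using eventually_ge_at_top[of M]
        by eventually_elim (use antimonoD[OF anti] \<open>?h M \<le> \<epsilon>\<close> in \<open>meson order_trans\<close>)
      then show ?thesis by (intro tendsto_upperbound[OF c(2)]) simp_all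
    qed
    then show "c = 0" using c(1) by (meson dense_ge antisym)
  qed
  then show ?thesis using iff by blast
qed

end
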